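(* Let $a\ge2$ be an integer. The orbits of rowmotion on the fence $\breve F(a,1,a,1,a)$ can be partitioned into three sets $\mathcal S,\mathcal M,\mathcal L$, called small, medium, and large, having the following properties. (a) We have $$\#\mathcal S=2a-2,\quad \#\mathcal M=1,\quad \#\mathcal L=a,$$ and $$\#\mathcal O=\begin{cases}a+1&\text{if }\mathcal O\in\mathcal S,\\ 3a+2&\text{if }\mathcal O\in\mathcal M,\\ a^2+2a&\text{if }\mathcal O\in\mathcal L.\end{cases}$$ (b) For rowmotion on antichains, $\chi$ is homometric with $$\chi(\mathcal O)=\begin{cases}3a&\text{if }\mathcal O\in\mathcal S,\\ 9a-3&\text{if }\mathcal O\in\mathcal M,\\ 3a^2+3a-2&\text{if }\mathcal O\in\mathcal L.\end{cases}$$ (c) The dihedral group orbits are pairs of orbits in $\mathcal S$ (that is, unions of two distinct orbits in $\mathcal S$) and single orbits in $\mathcal M$ and $\mathcal L$.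
   Context: The fence $\breve F(a,1,a,1,a)$ is the poset on $x_1,\dots,x_n$, $n=3a+1$, with covering relations $x_1\lhd\cdots\lhd x_a\rhd x_{a+1}\lhd x_{a+2}\lhd\cdots\lhd x_{2a+1}\rhd x_{2a+2}\lhd x_{2a+3}\lhd\cdots\lhd x_{3a+1}$. For a finite poset $P$, rowmotion on antichains is the bijection $\rho$ on the set of antichains sending $A$ to the set of minimal elements of $P\setminus I$, where $I$ is the (lower order) ideal generated by $A$. Rowmotion on ideals is the bijection $\hat\rho$ on the set $\mathcal I(P)$ of ideals sending $I$ to the ideal generated by the minimal elements of $P\setminus I$. Orbits are those of the cyclic groups generated by these maps; $A\mapsto$ (ideal generated by $A$) gives a size-preserving bijection between orbits of $\rho$ and of $\hat\rho$, and corresponding orbits are identified. For an orbit $\mathcal O$, $\#\mathcal O$ is the number of antichains (equivalently, ideals) in it, and $\chi(\mathcal O)=\sum_A\#A$ over the antichains $A$ in the orbit. The statistic $\chi$ is homometric if $\#\mathcal O_1=\#\mathcal O_2$ implies $\chi(\mathcal O_1)=\chi(\mathcal O_2)$ for all orbits $\mathcal O_1,\mathcal O_2$. The fence is self-dual via the order-reversing bijection $\kappa(x_k)=x_{n+1-k}$. The ideal complement of an ideal $I$ is $\overline I=\kappa(P\setminus I)$, where $P=\breve F(a,1,a,1,a)$. The dihedral group orbits are the orbits on $\mathcal I(P)$ of the group generated by $\hat\rho$ and $I\mapsto\overline I$.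
   Formalization: The claim in (b) that χ is homometric is stated only for a ≠ 2: for a = 2 the medium and large orbits both have size 8 but χ equals 15 and 16 respectively, so homometry fails there; all other claims are stated for every a ≥ 2. *)

theory Defs
  imports "HOL-Algebra.Group_Action" "HOL-Algebra.Generated_Groups"
begin

section \<open>Rowmotion on a finite poset\<close>

text \<open>A poset is given by its reflexive order relation \<open>r\<close>; the pair \<open>(x, y) \<in> r\<close> means that \<open>x\<close>
  lies weakly below \<open>y\<close>, and the set of elements is \<open>Field r\<close>.\<close>

definition antichains :: "'a rel \<Rightarrow> 'a set set" where
  "antichains r = {A. A \<subseteq> Field r \<and> (\<forall>x\<in>A. \<forall>y\<in>A. (x, y) \<in> r \<longrightarrow> x = y)}"

definition ideals :: "'a rel \<Rightarrow> 'a set set" where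
  "ideals r = {J. J \<subseteq> Field r \<and> (\<forall>x\<in>J. \<forall>y. (y, x) \<in> r \<longrightarrow> y \<in> J)}"

definition ideal_generated :: "'a rel \<Rightarrow> 'a set \<Rightarrow> 'a set" where
  "ideal_generated r A = {x. \<exists>y\<in>A. (x, y) \<in> r}"

definition minimal_elements :: "'a rel \<Rightarrow> 'a set \<Rightarrow> 'a set" where
  "minimal_elements r X = {x \<in> X. \<forall>y\<in>X. (y, x) \<in> r \<longrightarrow> y = x}"

definition rowmotion :: "'a rel \<Rightarrow> 'a set \<Rightarrow> 'a set" where
  "rowmotion r A = minimal_elements r (Field r - ideal_generated r A)"

definition ideal_rowmotion :: "'a rel \<Rightarrow> 'a set \<Rightarrow> 'a set" where
  "ideal_rowmotion r J = ideal_generated r (minimal_elements r (Field r - J))"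

text \<open>Orbits on \<open>X\<close> of the group generated by the bijections in \<open>F\<close> inside the group of all
  bijections of \<open>X\<close>. Elements of \<open>BijGroup X\<close> are extensional functions, whence the restriction.
  A map in \<open>F\<close> that does not restrict to a bijection of \<open>X\<close> would contribute nothing, as
  \<open>subgroup_generated\<close> intersects its second argument with the carrier.\<close>

definition generated_orbits :: "'b set \<Rightarrow> ('b \<Rightarrow> 'b) set \<Rightarrow> 'b set set" where
  "generated_orbits X F =
     orbits (subgroup_generated (BijGroup X) ((\<lambda>f. restrict f X) ` F)) X (\<lambda>g. g)"

definition rowmotion_orbits :: "'a rel \<Rightarrow> 'a set set set" where
  "rowmotion_orbits r = generated_orbits (antichains r) {rowmotion r}"

text \<open>The orbit of rowmotion on ideals that is identified with an orbit \<open>U\<close> of rowmotion on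
  antichains.\<close>

definition ideal_orbit :: "'a rel \<Rightarrow> 'a set set \<Rightarrow> 'a set set" where
  "ideal_orbit r U = ideal_generated r ` U"

definition chi :: "'a set set \<Rightarrow> nat" where
  "chi U = (\<Sum>A\<in>U. card A)"

definition chi_homometric :: "'a rel \<Rightarrow> bool" where
  "chi_homometric r \<longleftrightarrow>
     (\<forall>U\<in>rowmotion_orbits r. \<forall>V\<in>rowmotion_orbits r. card U = card V \<longrightarrow> chi U = chi V)"


section \<open>The fence with parameters $(a,1,a,1,a)$\<close>

text \<open>The element $x_k$ is represented by \<open>k\<close>. A pair \<open>(i, j)\<close> below says that $x_j$ covers
  $x_i$.\<close>

definition fence_covers :: "nat \<Rightarrow> nat rel" where
  "fence_covers a =
     {(i, i + 1) | i. i \<in> {1..<a} \<union> {a + 1..<2 * a + 1} \<union> {2 * a + 2..<3 * a + 1}}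
     \<union> {(a + 1, a), (2 * a + 2, 2 * a + 1)}"

definition fence :: "nat \<Rightarrow> nat rel" where
  "fence a = Restr ((fence_covers a)\<^sup>*) {1..3 * a + 1}"

lemma Field_fence: "Field (fence a) = {1..3 * a + 1}"
  unfolding fence_def Field_def by auto

lemma partial_order_on_fence:
  assumes "a \<ge> 2"
  shows "partial_order_on (Field (fence a)) (fence a)"
proof -
  define h where "h = (\<lambda>i. if i \<le> a then i else if i \<le> 2 * a + 1 then i - a else i - (2 * a + 1))"
  have "fence_covers a \<subseteq> measure h"
    using assms by (auto simp: fence_covers_def h_def)
  then have "acyclic (fence_covers a)"
    using wf_acyclic wf_measure wf_subset by blast
  then have "antisym ((fence_covers a)\<^sup>*)"
    by (rule acyclic_impl_antisym_rtrancl)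
  then have "antisym (fence a)"
    unfolding fence_def antisym_def by blast
  moreover have "trans (fence a)"
    unfolding fence_def trans_def by (auto intro: rtrancl_trans)
  moreover have "refl_on (Field (fence a)) (fence a)" "fence a \<subseteq> Field (fence a) \<times> Field (fence a)"
    unfolding Field_fence by (auto simp: fence_def refl_on_def)
  ultimately show ?thesis
    unfolding partial_order_on_def preorder_on_def by blast
qed

text \<open>With $n = 3a+1$, the order-reversing map $\kappa$ sends $x_k$ to $x_{n+1-k}$.\<close>

definition fence_dual :: "nat \<Rightarrow> nat \<Rightarrow> nat" where
  "fence_dual a k = 3 * a + 2 - k"

definition ideal_complement :: "nat \<Rightarrow> nat set \<Rightarrow> nat set" where
  "ideal_complement a J = fence_dual a ` (Field (fence a) - J)"

definition dihedral_orbits :: "nat \<Rightarrow> nat set set set" where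
  "dihedral_orbits a =
     generated_orbits (ideals (fence a)) {ideal_rowmotion (fence a), ideal_complement a}"

end

(* An ideal of the fence is determined by how many elements p, q, r it contains of the three
   ascending segments. In these coordinates rowmotion raises each of p, q, r by one, unless that
   segment is full or its top is blocked, in which case the coordinate falls back to 0, or to 1 when
   the maximal element of the segment to the left is being added. Cut every orbit where q falls
   back. Between two cuts p and r advance cyclically, so the first-return map to the cut is explicit:
   it fixes 2a - 2 states (small orbits), permutes three states cyclically (medium orbit), and acts
   on the remaining a^2 states as (u, v) -> (u + 1, v + 1) on a torus Z/a x Z/a (a large orbits).
   An antichain has three elements, less one for each coordinate that has just fallen back, so chi is
   three times the orbit size minus the number of times p, q, r fall back. The ideal complement
   reverses rowmotion, hence maps orbits to orbits; it is enough to follow one state per orbit. *)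

theory Submission
  imports Defs
begin

section \<open>Orbits of groups generated by bijections of a finite set\<close>

text \<open>The cut is made in \<open>q\<close> because the segments influence each other only when
  \<open>q\<close> is 0, \<open>a\<close> or \<open>a + 1\<close>: x_a is blocked only while
  \<open>q = 0\<close>, x_{2a+1} is added or blocked only at \<open>q = a\<close>, and
  \<open>q\<close> restarts at 1 only as it falls back. All irregularities thus sit at the ends of a
  run; in between, \<open>p\<close> and \<open>r\<close> rotate with period \<open>a + 1\<close>. A
  run has length \<open>a\<close>, \<open>a + 1\<close> or \<open>a + 2\<close>, and up to end
  effects the return map moves \<open>p\<close> and \<open>r\<close> by the excess over
  \<open>a + 1\<close>. Length \<open>a + 1\<close> gives the fixed states, length
  \<open>a + 2\<close> a shift by one; the end effects at \<open>(a - 1, 0, 1)\<close> and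
  \<open>(a, 1, 1)\<close> and the only run of length \<open>a\<close>, from
  \<open>(a, 1, 2)\<close>, make up the medium cycle. On the shifted states \<open>q = 0\<close>, so
  \<open>p = a\<close> cannot occur, and \<open>r = 1\<close> is the value that shortens the run;
  each coordinate keeps \<open>a\<close> values, whence the side \<open>a\<close> of the torus. An
  orbit meets the cross-section exactly in the cycle it is built from, and this trace tells orbits
  apart.\<close>

definition reachable :: "('b \<Rightarrow> 'b) set \<Rightarrow> 'b \<Rightarrow> 'b set" where
  "reachable F x = {(u, f u) | u f. f \<in> F}\<^sup>* `` {x}"

lemma reachable_refl [simp]: "x \<in> reachable F x"
  by (simp add: reachable_def)

lemma reachable_step: "y \<in> reachable F x \<Longrightarrow> f \<in> F \<Longrightarrow> f y \<in> reachable F x"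
  unfolding reachable_def by (auto intro: rtrancl_into_rtrancl)

lemma reachable_trans: "y \<in> reachable F x \<Longrightarrow> z \<in> reachable F y \<Longrightarrow> z \<in> reachable F x"
  unfolding reachable_def by auto

lemma reachable_induct [consumes 1, case_names refl step]:
  assumes "y \<in> reachable F x" and "P x"
    and "\<And>u f. u \<in> reachable F x \<Longrightarrow> P u \<Longrightarrow> f \<in> F \<Longrightarrow> P (f u)"
  shows "P y"
proof -
  have "(x, y) \<in> {(u, f u) | u f. f \<in> F}\<^sup>*"
    using assms(1) by (simp add: reachable_def)
  then show ?thesis
  proof (induction rule: rtrancl_induct)
    case (step u v)
    then show ?case using assms(3) by (auto simp: reachable_def)
  qed (fact assms(2))
qed

lemma reachable_minimal:
  assumes "x \<in> S" and "\<And>u f. u \<in> S \<Longrightarrow> f \<in> F \<Longrightarrow> f u \<in> S"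
  shows "reachable F x \<subseteq> S"
proof
  fix y assume "y \<in> reachable F x"
  then show "y \<in> S" by (induction rule: reachable_induct) (use assms in auto)
qed

lemma reachable_subset:
  assumes "\<And>f. f \<in> F \<Longrightarrow> f \<in> X \<rightarrow> X" and "x \<in> X"
  shows "reachable F x \<subseteq> X"
  by (rule reachable_minimal) (use assms in auto)

text \<open>In a finite set the inverse of a bijection is one of its powers, so forward steps suffice.\<close>

lemma reachable_backwards:
  assumes "finite X" and "\<And>f. f \<in> F \<Longrightarrow> bij_betw f X X" and "f \<in> F" and "x \<in> X"
  shows "x \<in> reachable F (f x)"
proof -
  have f: "bij_betw f X X" using assms by blast
  let ?A = "reachable F (f x)"
  have sub: "?A \<subseteq> X"
    by (rule reachable_subset) (use assms in \<open>auto intro: bij_betw_apply\<close>)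
  then have inj: "inj_on f ?A"
    using f by (auto simp: bij_betw_def intro: inj_on_subset)
  have "f ` ?A \<subseteq> ?A" by (auto intro: reachable_step assms)
  then have "f ` ?A = ?A"
    using inj sub assms(1) by (metis endo_inj_surj finite_subset)
  then obtain z where z: "z \<in> ?A" "f z = f x" by (metis imageE reachable_refl)
  then have "z = x" using f sub assms(4) by (auto simp: bij_betw_def inj_on_def)
  with z show ?thesis by simp
qed

lemma reachable_sym:
  assumes "finite X" and "\<And>f. f \<in> F \<Longrightarrow> bij_betw f X X" and "x \<in> X" and "y \<in> reachable F x"
  shows "x \<in> reachable F y"
  using assms(4)
proof (induction rule: reachable_induct)
  case (step u f)
  have "reachable F x \<subseteq> X"
    by (rule reachable_subset) (use assms in \<open>auto intro: bij_betw_apply\<close>)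
  with step have "u \<in> reachable F (f u)" by (intro reachable_backwards[of X]) (use assms in auto)
  with step show ?case by (blast intro: reachable_trans)
qed simp

lemma reachable_eq:
  assumes "finite X" and "\<And>f. f \<in> F \<Longrightarrow> bij_betw f X X" and "x \<in> X" and "y \<in> reachable F x"
  shows "reachable F y = reachable F x"
  using reachable_sym[OF assms] assms(4) by (blast intro: reachable_trans)

text \<open>This removes groups from the rest of the development. An inverse generator sends
  \<open>x\<close> to a point that is forward reachable by finiteness; conversely, a forward path is
  the evaluation at \<open>x\<close> of a product of generators.\<close>

lemma generated_orbits_eq:
  fixes F :: "('b \<Rightarrow> 'b) set"
  assumes "finite X" and bij: "\<And>f. f \<in> F \<Longrightarrow> bij_betw f X X"
  shows "generated_orbits X F = reachable F ` X"
proof -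
  let ?G = "BijGroup X"
  let ?H = "(\<lambda>f. restrict f X) ` F"
  let ?C = "generate ?G ?H"
  have H: "?H \<subseteq> Bij X"
    using bij by (auto simp: Bij_def)
  have cB: "carrier ?G = Bij X"
    by (simp add: BijGroup_def)
  have carr: "carrier (subgroup_generated ?G ?H) = ?C"
    unfolding carrier_subgroup_generated cB using H by (simp only: Int_absorb1)
  have gen: "\<And>h. h \<in> ?C \<Longrightarrow> h \<in> Bij X"
    using group.generate_in_carrier[OF group_BijGroup, of ?H X] H unfolding cB by blast
  \<comment> \<open>Stated for all \<open>x\<close> at once, so that in a product the claim for
    \<open>h1\<close> can be used at the point \<open>h2 x\<close>.\<close>
  have fwd: "\<forall>x\<in>X. h x \<in> reachable F x" if "h \<in> ?C" for h
    using that
  proof (induction rule: generate.induct)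
    case one
    then show ?case by (simp add: BijGroup_def)
  next
    case (incl h)
    then show ?case by (auto intro: reachable_step[OF reachable_refl])
  next
    case (inv h)
    then obtain f where f: "f \<in> F" "h = restrict f X" by auto
    show ?case
    proof
      fix x assume x: "x \<in> X"
      have hB: "h \<in> Bij X" using inv H by auto
      have ix: "inv\<^bsub>?G\<^esub> h = (\<lambda>x\<in>X. inv_into X h x)" using hB by (rule inv_BijGroup)
      let ?y = "inv_into X h x"
      have y: "?y \<in> X" "f ?y = x"
      proof -
        show "?y \<in> X" using Bij_inv_into_mem[OF hB x] .
        have "h ?y = x"
          using hB x by (intro f_inv_into_f) (auto simp: Bij_def bij_betw_def)
        then show "f ?y = x" using \<open>?y \<in> X\<close> f by simp
      qed
      then have "?y \<in> reachable F x"
        using reachable_backwards[OF assms f(1) y(1)] by simp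
      then show "(inv\<^bsub>?G\<^esub> h) x \<in> reachable F x" using ix x by simp
    qed
  next
    case (eng h1 h2)
    have B: "h1 \<in> Bij X" "h2 \<in> Bij X" using eng gen by auto
    then have "h1 \<otimes>\<^bsub>?G\<^esub> h2 = compose X h1 h2" by (simp add: BijGroup_def)
    moreover have "h2 x \<in> X" if "x \<in> X" for x using B that by (auto simp: Bij_def bij_betw_def)
    ultimately show ?case using eng by (auto simp: compose_def intro: reachable_trans)
  qed
  have "orbit (subgroup_generated ?G ?H) (\<lambda>g. g) x = reachable F x" if x: "x \<in> X" for x
  proof
    show "orbit (subgroup_generated ?G ?H) (\<lambda>g. g) x \<subseteq> reachable F x"
      using fwd x by (auto simp: orbit_def carr)
    show "reachable F x \<subseteq> orbit (subgroup_generated ?G ?H) (\<lambda>g. g) x"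
    proof
      fix y assume "y \<in> reachable F x"
      then have "\<exists>h\<in>?C. y = h x"
      proof (induction rule: reachable_induct)
        case refl
        have "\<one>\<^bsub>?G\<^esub> \<in> ?C" by (rule generate.one)
        moreover have "\<one>\<^bsub>?G\<^esub> x = x" using x by (simp add: BijGroup_def)
        ultimately show ?case by metis
      next
        case (step u f)
        then obtain h where h: "h \<in> ?C" "u = h x" by blast
        let ?f = "restrict f X"
        have f: "?f \<in> ?H" using step by auto
        have hx: "h x \<in> X" using gen[OF h(1)] x by (auto simp: Bij_def bij_betw_def)
        have "?f \<otimes>\<^bsub>?G\<^esub> h \<in> ?C" using f h by (blast intro: generate.eng generate.incl)
        moreover have "(?f \<otimes>\<^bsub>?G\<^esub> h) x = f u"
          using f H gen[OF h(1)] x h(2) hx by (auto simp: BijGroup_def compose_def)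
        ultimately show ?case by metis
      qed
      then show "y \<in> orbit (subgroup_generated ?G ?H) (\<lambda>g. g) x"
        by (auto simp: orbit_def carr)
    qed
  qed
  then show ?thesis
    unfolding generated_orbits_def orbits_def by (auto simp: image_iff)
qed

lemma reachable_conjugate:
  assumes "\<And>f. f \<in> F \<Longrightarrow> f \<in> X \<rightarrow> X" and "x \<in> X"
    and "\<And>f. f \<in> F \<Longrightarrow> \<exists>g\<in>F'. \<forall>x\<in>X. g (\<phi> x) = \<phi> (f x)"
    and "\<And>g. g \<in> F' \<Longrightarrow> \<exists>f\<in>F. \<forall>x\<in>X. g (\<phi> x) = \<phi> (f x)"
  shows "reachable F' (\<phi> x) = \<phi> ` reachable F x"
proof
  have sub: "reachable F x \<subseteq> X" using assms(1,2) by (rule reachable_subset)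
  show "reachable F' (\<phi> x) \<subseteq> \<phi> ` reachable F x"
  proof (rule reachable_minimal)
    fix u g assume "u \<in> \<phi> ` reachable F x" "g \<in> F'"
    then show "g u \<in> \<phi> ` reachable F x"
      using assms(4)[of g] sub by (force intro: reachable_step)
  qed simp
  show "\<phi> ` reachable F x \<subseteq> reachable F' (\<phi> x)"
  proof
    fix v assume "v \<in> \<phi> ` reachable F x"
    then obtain y where "y \<in> reachable F x" and v: "v = \<phi> y" by auto
    then have "\<phi> y \<in> reachable F' (\<phi> x)"
    proof (induction arbitrary: v rule: reachable_induct)
      case (step u f)
      then obtain g where "g \<in> F'" "g (\<phi> u) = \<phi> (f u)" using assms(3) sub by blast
      with step show ?case by (metis reachable_step)
    qed simp
    then show "v \<in> reachable F' (\<phi> x)" using v by simp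
  qed
qed

text \<open>Carries orbits of coordinate triples over to antichains and to ideals. The maps in
  \<open>F'\<close> inherit bijectivity: they are surjective on the finite image.\<close>

lemma generated_orbits_conjugate:
  assumes "finite X" and "inj_on \<phi> X" and bij: "\<And>f. f \<in> F \<Longrightarrow> bij_betw f X X"
    and 1: "\<And>f. f \<in> F \<Longrightarrow> \<exists>g\<in>F'. \<forall>x\<in>X. g (\<phi> x) = \<phi> (f x)"
    and 2: "\<And>g. g \<in> F' \<Longrightarrow> \<exists>f\<in>F. \<forall>x\<in>X. g (\<phi> x) = \<phi> (f x)"
  shows "generated_orbits (\<phi> ` X) F' = (`) \<phi> ` generated_orbits X F"
proof -
  have FX: "f \<in> X \<rightarrow> X" if "f \<in> F" for f
    using bij[OF that] by (auto intro: bij_betw_apply)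
  have "bij_betw g (\<phi> ` X) (\<phi> ` X)" if "g \<in> F'" for g
  proof -
    obtain f where f: "f \<in> F" "\<forall>x\<in>X. g (\<phi> x) = \<phi> (f x)" using 2 \<open>g \<in> F'\<close> by blast
    then have fX: "f ` X = X" using bij by (auto simp: bij_betw_def)
    have "g ` \<phi> ` X = \<phi> ` f ` X" unfolding image_image using f by (auto intro!: image_cong)
    then have "g ` \<phi> ` X = \<phi> ` X" using fX by simp
    then show ?thesis
      using assms(1) by (simp add: bij_betw_def finite_surj_inj)
  qed
  then have "generated_orbits (\<phi> ` X) F' = reachable F' ` \<phi> ` X"
    using assms(1) by (intro generated_orbits_eq) auto
  also have "\<dots> = (\<lambda>x. \<phi> ` reachable F x) ` X"
    unfolding image_image
    by (intro image_cong refl reachable_conjugate[of F X] 1 2 FX)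
  also have "\<dots> = (`) \<phi> ` generated_orbits X F"
    using generated_orbits_eq[OF assms(1) bij] by (simp add: image_image)
  finally show ?thesis .
qed

section \<open>First returns to a cross-section\<close>

text \<open>Every orbit of \<open>f\<close> is cut into runs, each starting at its only element in \<open>T\<close>;
  \<open>\<tau>\<close> is the length of a run.\<close>

locale first_return =
  fixes f :: "'b \<Rightarrow> 'b" and X T :: "'b set" and \<tau> :: "'b \<Rightarrow> nat"
  assumes finite_X: "finite X" and bij: "bij_betw f X X" and T_subset: "T \<subseteq> X"
    and return_pos: "t \<in> T \<Longrightarrow> 0 < \<tau> t"
    and return: "t \<in> T \<Longrightarrow> (f ^^ \<tau> t) t \<in> T"
    and no_return: "t \<in> T \<Longrightarrow> 0 < k \<Longrightarrow> k < \<tau> t \<Longrightarrow> (f ^^ k) t \<notin> T"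
    and hits: "x \<in> X \<Longrightarrow> \<exists>k. (f ^^ k) x \<in> T"
begin

definition run :: "'b \<Rightarrow> 'b set" where
  "run t = (\<lambda>k. (f ^^ k) t) ` {..<\<tau> t}"

lemma funpow_in: "x \<in> X \<Longrightarrow> (f ^^ k) x \<in> X"
  by (induction k) (use bij in \<open>auto intro: bij_betw_apply\<close>)

lemma funpow_reachable: "(f ^^ k) x \<in> reachable {f} x"
  by (induction k) (auto intro: reachable_step)

lemma reachable_eq_single: "x \<in> X \<Longrightarrow> y \<in> reachable {f} x \<Longrightarrow> reachable {f} y = reachable {f} x"
  by (rule reachable_eq[of X]) (use finite_X bij in auto)

lemma start_in_run: "t \<in> T \<Longrightarrow> t \<in> run t"
  unfolding run_def by (rule image_eqI[of _ _ 0]) (auto intro: return_pos)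

lemma run_Int: "t \<in> T \<Longrightarrow> run t \<inter> T = {t}"
proof -
  assume t: "t \<in> T"
  have "t \<in> run t" using t by (rule start_in_run)
  moreover have "s = t" if s: "s \<in> run t" "s \<in> T" for s
  proof -
    obtain k where k: "s = (f ^^ k) t" "k < \<tau> t"
      using s(1) unfolding run_def by blast
    then have "k = 0" using no_return[OF t, of k] s by auto
    with k show ?thesis by simp
  qed
  ultimately show ?thesis using t by auto
qed

text \<open>Cancelling the injective \<open>f ^^ i\<close> puts \<open>s\<close> on the run of
  \<open>t\<close> at time \<open>j - i\<close>, and a run meets \<open>T\<close> only at time 0.
  Hence runs are disjoint and free of repetitions.\<close>

lemma run_unique:
  assumes "s \<in> T" "t \<in> T" "i \<le> j" "j < \<tau> t" "(f ^^ i) s = (f ^^ j) t"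
  shows "s = t \<and> i = j"
proof -
  have "inj_on (f ^^ i) X" using bij_betw_funpow[OF bij] by (auto simp: bij_betw_def)
  moreover have "(f ^^ i) s = (f ^^ i) ((f ^^ (j - i)) t)"
    using assms by (metis funpow_add comp_apply le_add_diff_inverse)
  ultimately have s: "s = (f ^^ (j - i)) t"
    using assms T_subset funpow_in by (meson inj_onD subsetD)
  then have "j - i = 0" using no_return[OF assms(2), of "j - i"] assms by fastforce
  with s assms show ?thesis by simp
qed

lemma inj_on_run_param: "inj_on (\<lambda>(t, k). (f ^^ k) t) (SIGMA t:T. {..<\<tau> t})"
proof (rule inj_onI, clarsimp)
  fix s i t j assume *: "s \<in> T" "t \<in> T" "i < \<tau> s" "j < \<tau> t" "(f ^^ i) s = (f ^^ j) t"
  show "s = t \<and> i = j"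
    using run_unique[of s t i j] run_unique[of t s j i] * by (cases "i \<le> j") auto
qed

lemma sum_runs:
  assumes "C \<subseteq> T"
  shows "sum g (\<Union>t\<in>C. run t) = (\<Sum>t\<in>C. \<Sum>k<\<tau> t. g ((f ^^ k) t))"
proof -
  let ?S = "SIGMA t:C. {..<\<tau> t}"
  have eq: "(\<Union>t\<in>C. run t) = (\<lambda>(t, k). (f ^^ k) t) ` ?S"
    by (auto simp: run_def)
  have "inj_on (\<lambda>(t, k). (f ^^ k) t) ?S"
    by (rule inj_on_subset[OF inj_on_run_param]) (use assms in auto)
  then have "sum g (\<Union>t\<in>C. run t) = (\<Sum>(t, k)\<in>?S. g ((f ^^ k) t))"
    unfolding eq by (subst sum.reindex) (auto simp: case_prod_unfold)
  also have "\<dots> = (\<Sum>t\<in>C. \<Sum>k<\<tau> t. g ((f ^^ k) t))"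
    using assms finite_X T_subset by (subst sum.Sigma) (auto intro: finite_subset)
  finally show ?thesis .
qed

lemma card_runs: "C \<subseteq> T \<Longrightarrow> card (\<Union>t\<in>C. run t) = (\<Sum>t\<in>C. \<tau> t)"
  unfolding card_eq_sum by (subst sum_runs) auto

lemma runs_Int: "C \<subseteq> T \<Longrightarrow> (\<Union>t\<in>C. run t) \<inter> T = C"
proof -
  assume C: "C \<subseteq> T"
  have "(\<Union>t\<in>C. run t) \<inter> T = (\<Union>t\<in>C. run t \<inter> T)" by blast
  also have "\<dots> = (\<Union>t\<in>C. {t})" using C run_Int by (intro SUP_cong) auto
  finally show ?thesis by simp
qed

text \<open>The last step of a run leads to the start of the next one, so closure of
  \<open>C\<close> under the return map makes the union of runs closed under
  \<open>f\<close>.\<close>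

lemma reachable_eq_runs:
  assumes "C \<subseteq> T" "t \<in> C" "\<And>s. s \<in> C \<Longrightarrow> (f ^^ \<tau> s) s \<in> C" "C \<subseteq> reachable {f} t"
  shows "reachable {f} t = (\<Union>s\<in>C. run s)"
proof
  show "reachable {f} t \<subseteq> (\<Union>s\<in>C. run s)"
  proof (rule reachable_minimal)
    show "t \<in> (\<Union>s\<in>C. run s)" using assms(1,2) start_in_run by blast
    fix u g assume "u \<in> (\<Union>s\<in>C. run s)" "g \<in> {f}"
    then obtain s k where s: "s \<in> C" "k < \<tau> s" "u = (f ^^ k) s" and g: "g = f"
      by (auto simp: run_def)
    have u: "g u = (f ^^ Suc k) s" using s g by simp
    show "g u \<in> (\<Union>s\<in>C. run s)"
    proof (cases "Suc k < \<tau> s")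
      case True
      then show ?thesis using s u unfolding run_def by blast
    next
      case False
      then have "Suc k = \<tau> s" using s by simp
      then have "g u \<in> C" using u assms s by metis
      then show ?thesis using assms(1) start_in_run by blast
    qed
  qed
  show "(\<Union>s\<in>C. run s) \<subseteq> reachable {f} t"
    using assms(4) funpow_reachable by (auto simp: run_def intro: reachable_trans)
qed

lemma generated_orbits_section: "generated_orbits X {f} = reachable {f} ` T"
proof -
  have "generated_orbits X {f} = reachable {f} ` X"
    by (rule generated_orbits_eq) (use finite_X bij in auto)
  also have "\<dots> = reachable {f} ` T"
  proof
    show "reachable {f} ` X \<subseteq> reachable {f} ` T"
    proof clarify
      fix x assume x: "x \<in> X"
      then obtain k where "(f ^^ k) x \<in> T" using hits by blast
      then show "reachable {f} x \<in> reachable {f} ` T"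
        using reachable_eq_single[OF x funpow_reachable] by (metis image_eqI)
    qed
  qed (use T_subset in auto)
  finally show ?thesis .
qed

text \<open>The last hypothesis says that the involution \<open>c\<close> conjugates
  \<open>f\<close> to its inverse. The group is thus dihedral, and an orbit consists of at most two
  orbits of \<open>f\<close>.\<close>

lemma generated_orbits_reversing:
  assumes c: "c \<in> X \<rightarrow> X" "\<And>x. x \<in> X \<Longrightarrow> c (c x) = x" "\<And>x. x \<in> X \<Longrightarrow> f (c (f x)) = c x"
  shows "generated_orbits X {f, c} = (\<lambda>t. reachable {f} t \<union> reachable {f} (c t)) ` T"
proof -
  have cb: "bij_betw c X X"
    by (rule bij_betw_byWitness[of _ c]) (use c in auto)
  have sub: "reachable {f} x \<subseteq> X" if "x \<in> X" for x
    by (rule reachable_subset) (use bij that in \<open>auto intro: bij_betw_apply\<close>)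
  have R: "reachable {f, c} x = reachable {f} x \<union> reachable {f} (c x)" if x: "x \<in> X" for x
  proof
    \<comment> \<open>\<open>c (f u)\<close> lies one step before \<open>c u\<close>, and a backward
      step stays in the orbit.\<close>
    have key: "c y \<in> reachable {f} (c z)" if z: "z \<in> X" and y: "y \<in> reachable {f} z" for y z
      using y
    proof (induction rule: reachable_induct)
      case (step u g)
      have u: "u \<in> X" using step sub z by auto
      then have "c (f u) \<in> X" using c(1) bij by (auto intro: bij_betw_apply)
      then have "c (f u) \<in> reachable {f} (f (c (f u)))"
        using reachable_backwards[OF finite_X, of "{f}" f] bij by auto
      then show ?case using step c(3)[OF u] by (auto intro: reachable_trans)
    qed simp
    have cx: "c x \<in> X" using c x by auto
    show "reachable {f, c} x \<subseteq> reachable {f} x \<union> reachable {f} (c x)"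
    proof (rule reachable_minimal)
      fix u g assume u: "u \<in> reachable {f} x \<union> reachable {f} (c x)" and g: "g \<in> {f, c}"
      show "g u \<in> reachable {f} x \<union> reachable {f} (c x)"
        using g u key[OF x] key[OF cx] c(2)[OF x] by (auto intro: reachable_step)
    qed simp
    have mono: "reachable {f} y \<subseteq> reachable {f, c} y" for y
      by (rule reachable_minimal) (auto intro: reachable_step)
    have "c x \<in> reachable {f, c} x" by (rule reachable_step) auto
    with mono show "reachable {f} x \<union> reachable {f} (c x) \<subseteq> reachable {f, c} x"
      by (auto intro: reachable_trans)
  qed
  have E: "reachable {f, c} y = reachable {f, c} x" if "x \<in> X" "y \<in> reachable {f, c} x" for x y
    by (rule reachable_eq[of X]) (use that finite_X bij cb in auto)
  have "generated_orbits X {f, c} = reachable {f, c} ` X"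
    by (rule generated_orbits_eq) (use finite_X bij cb in auto)
  also have "\<dots> = reachable {f, c} ` T"
  proof
    show "reachable {f, c} ` X \<subseteq> reachable {f, c} ` T"
    proof clarify
      fix x assume x: "x \<in> X"
      then obtain k where k: "(f ^^ k) x \<in> T" using hits by blast
      have "(f ^^ k) x \<in> reachable {f, c} x" using R[OF x] funpow_reachable by blast
      then show "reachable {f, c} x \<in> reachable {f, c} ` T"
        using E[OF x] k by (metis image_eqI)
    qed
  qed (use T_subset in auto)
  also have "\<dots> = (\<lambda>t. reachable {f} t \<union> reachable {f} (c t)) ` T"
    by (intro image_cong refl R) (use T_subset in auto)
  finally show ?thesis .
qed

end

section \<open>Coordinates for rowmotion on the fence\<close>

text \<open>The triple \<open>(p, q, r)\<close> stands for the ideal containing the lowest \<open>p\<close>, \<open>q\<close> and \<open>r\<close>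
  elements of the three ascending segments of the fence.\<close>

type_synonym state = "nat \<times> nat \<times> nat"

text \<open>The two implications encode the only relations between segments: x_a lies above x_{a+1},
  and x_{2a+1} above x_{2a+2}.\<close>

definition states :: "nat \<Rightarrow> state set" where
  "states a = {(p, q, r). p \<le> a \<and> q \<le> a + 1 \<and> r \<le> a \<and> (p = a \<longrightarrow> 0 < q) \<and> (q = a + 1 \<longrightarrow> 0 < r)}"

fun ideal_of :: "nat \<Rightarrow> state \<Rightarrow> nat set" where
  "ideal_of a (p, q, r) = {0<..p} \<union> {a<..a + q} \<union> {2 * a + 1<..2 * a + 1 + r}"

text \<open>These are the maximal elements of \<open>ideal_of a (p, q, r)\<close>: the bottom of the
  second segment is dropped if x_a is present above it, and the bottom of the third if x_{2a+1}
  is.\<close>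

fun antichain_of :: "nat \<Rightarrow> state \<Rightarrow> nat set" where
  "antichain_of a (p, q, r) =
     (if 0 < p then {p} else {}) \<union>
     (if q = 0 \<or> q = 1 \<and> p = a then {} else {a + q}) \<union>
     (if r = 0 \<or> r = 1 \<and> q = a + 1 then {} else {2 * a + 1 + r})"

text \<open>A top x_a or x_{2a+1} is blocked while the bottom of the next segment is missing. Where
  \<open>q\<close> falls back, \<open>q \<ge> a\<close>, so \<open>p + 1 = a\<close> means that x_a
  is added and brings x_{a+1} with it; where \<open>r\<close> falls back, \<open>q = a\<close> does
  the same for x_{2a+1} and x_{2a+2}.\<close>

fun step :: "nat \<Rightarrow> state \<Rightarrow> state" where
  "step a (p, q, r) =
    (if p + 1 < a \<or> p + 1 = a \<and> 0 < q then p + 1 else 0,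
     if q < a \<or> q = a \<and> 0 < r then q + 1 else if p + 1 = a then 1 else 0,
     if r < a then r + 1 else if q = a then 1 else 0)"

text \<open>Complementing replaces each count by the number of missing elements, and \<kappa>
  reverses the order of the segments.\<close>

fun dual :: "nat \<Rightarrow> state \<Rightarrow> state" where
  "dual a (p, q, r) = (a - r, a + 1 - q, a - p)"

section \<open>The order of the fence, its ideals and its antichains in coordinates\<close>

lemma finite_states: "finite (states a)"
  by (rule finite_subset[of _ "{..a} \<times> {..a + 1} \<times> {..a}"]) (auto simp: states_def)

text \<open>x_{a+1} and x_{2a+2} are minimal, x_a and x_{2a+1} maximal, so the two covers across
  segments compose with no other cover; all other chains stay in one segment.\<close>

lemma fence_iff:
  assumes "0 < a"
  shows "(x, y) \<in> fence a \<longleftrightarrow>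
     0 < x \<and> x \<le> y \<and> y \<le> a \<or> a < x \<and> x \<le> y \<and> y \<le> 2 * a + 1 \<or>
     2 * a + 1 < x \<and> x \<le> y \<and> y \<le> 3 * a + 1 \<or>
     x = a + 1 \<and> y = a \<or> x = 2 * a + 2 \<and> y = 2 * a + 1"
  (is "_ \<longleftrightarrow> ?le x y")
proof
  assume "(x, y) \<in> fence a"
  then have *: "(x, y) \<in> (fence_covers a)\<^sup>*" "1 \<le> x" "x \<le> 3 * a + 1"
    by (auto simp: fence_def)
  from *(1) show "?le x y"
  proof (induction rule: rtrancl_induct)
    case base
    consider "x \<le> a" | "a < x" "x \<le> 2 * a + 1" | "2 * a + 1 < x" by linarith
    then show ?case using *(2,3) by cases simp_all
  next
    case (step y z)
    from step(2) have "z = y + 1 \<and> (1 \<le> y \<and> y < a \<or> a < y \<and> y < 2 * a + 1 \<or> 2 * a + 1 < y \<and> y < 3 * a + 1)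
      \<or> y = a + 1 \<and> z = a \<or> y = 2 * a + 2 \<and> z = 2 * a + 1"
      unfolding fence_covers_def by auto
    then show ?case using step(3) assms by (elim disjE conjE; simp)
  qed
next
  have up: "(x, y) \<in> (fence_covers a)\<^sup>*"
    if "x \<le> y" "{x..<y} \<subseteq> {1..<a} \<union> {a + 1..<2 * a + 1} \<union> {2 * a + 2..<3 * a + 1}" for x y
    using that(2)
  proof (induction rule: dec_induct[OF that(1)])
    case (2 n)
    have "n \<in> {1..<a} \<union> {a + 1..<2 * a + 1} \<union> {2 * a + 2..<3 * a + 1}"
      using 2(1,2,4) by (meson atLeastLessThan_iff lessI subsetD)
    then have "(n, Suc n) \<in> fence_covers a" unfolding fence_covers_def by auto
    moreover have "{x..<n} \<subseteq> {x..<Suc n}" by auto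
    then have "(x, n) \<in> (fence_covers a)\<^sup>*" using 2(3,4) by blast
    ultimately show ?case by (rule rtrancl_into_rtrancl[rotated])
  qed simp
  assume le: "?le x y"
  have "(a + 1, a) \<in> fence_covers a" "(2 * a + 2, 2 * a + 1) \<in> fence_covers a"
    by (simp_all add: fence_covers_def)
  then have "(x, y) \<in> (fence_covers a)\<^sup>*"
    using le by (elim disjE) (auto intro!: up)
  moreover have "1 \<le> x \<and> x \<le> 3 * a + 1 \<and> 1 \<le> y \<and> y \<le> 3 * a + 1"
    using le assms by (elim disjE conjE; simp)
  ultimately show "(x, y) \<in> fence a" by (simp add: fence_def)
qed

lemma fence_iff_segment:
  assumes "0 < a"
  shows "x \<le> a \<Longrightarrow> (x, y) \<in> fence a \<longleftrightarrow> 0 < x \<and> x \<le> y \<and> y \<le> a"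
    and "a < x \<Longrightarrow> x \<le> 2 * a + 1 \<Longrightarrow>
      (x, y) \<in> fence a \<longleftrightarrow> x \<le> y \<and> y \<le> 2 * a + 1 \<or> x = a + 1 \<and> y = a"
    and "2 * a + 1 < x \<Longrightarrow>
      (x, y) \<in> fence a \<longleftrightarrow> x \<le> y \<and> y \<le> 3 * a + 1 \<or> x = 2 * a + 2 \<and> y = 2 * a + 1"
  using assms by (auto simp: fence_iff)

lemma downset_of_interval:
  fixes S :: "nat set"
  assumes "S \<subseteq> {l<..l + m}" and "\<And>x y. x \<in> S \<Longrightarrow> l < y \<Longrightarrow> y \<le> x \<Longrightarrow> y \<in> S"
  shows "\<exists>p\<le>m. S = {l<..l + p}"
proof (cases "S = {}")
  case False
  have fin: "finite S" using assms(1) finite_subset by auto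
  let ?M = "Max S"
  have M: "?M \<in> S" using fin False by simp
  then have "l < ?M" "?M \<le> l + m" using assms(1) by auto
  moreover have "S = {l<..?M}"
    using assms fin M by (auto intro: assms(2)[of ?M])
  ultimately show ?thesis by (intro exI[of _ "?M - l"]) auto
qed auto

lemma mem_ideal_of_segment:
  assumes "(p, q, r) \<in> states a"
  shows "x \<le> a \<Longrightarrow> x \<in> ideal_of a (p, q, r) \<longleftrightarrow> 0 < x \<and> x \<le> p"
    and "a < x \<Longrightarrow> x \<le> 2 * a + 1 \<Longrightarrow> x \<in> ideal_of a (p, q, r) \<longleftrightarrow> x \<le> a + q"
    and "2 * a + 1 < x \<Longrightarrow> x \<in> ideal_of a (p, q, r) \<longleftrightarrow> x \<le> 2 * a + 1 + r"
  using assms by (auto simp: states_def)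

lemma mem_antichain_of_segment:
  assumes "(p, q, r) \<in> states a"
  shows "x \<le> a \<Longrightarrow> x \<in> antichain_of a (p, q, r) \<longleftrightarrow> 0 < x \<and> x = p"
    and "a < x \<Longrightarrow> x \<le> 2 * a + 1 \<Longrightarrow>
      x \<in> antichain_of a (p, q, r) \<longleftrightarrow> x = a + q \<and> \<not> (q = 1 \<and> p = a)"
    and "2 * a + 1 < x \<Longrightarrow>
      x \<in> antichain_of a (p, q, r) \<longleftrightarrow> x = 2 * a + 1 + r \<and> \<not> (r = 1 \<and> q = a + 1)"
  using assms by (auto simp: states_def)

lemma segment_cases [case_names low mid high]:
  fixes x a :: nat
  obtains "x \<le> a" | "a < x" "x \<le> 2 * a + 1" | "2 * a + 1 < x"
  by linarith

lemma ideal_of_in_ideals: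
  assumes "0 < a" and "t \<in> states a"
  shows "ideal_of a t \<in> ideals (fence a)"
proof -
  obtain p q r where t: "t = (p, q, r)" by (metis prod_cases3)
  have pqr: "p \<le> a" "q \<le> a + 1" "r \<le> a" "p = a \<Longrightarrow> 0 < q" "q = a + 1 \<Longrightarrow> 0 < r"
    using assms(2) by (auto simp: t states_def)
  have "y \<in> ideal_of a t" if "x \<in> ideal_of a t" "(y, x) \<in> fence a" for x y
    using that assms pqr unfolding t
    by (cases x a rule: segment_cases; cases y a rule: segment_cases)
       (auto simp: mem_ideal_of_segment fence_iff_segment simp del: ideal_of.simps)
  moreover have "ideal_of a t \<subseteq> Field (fence a)"
    using pqr by (auto simp: t Field_fence)
  ultimately show ?thesis by (auto simp: ideals_def)
qed

text \<open>Each segment is a chain, so an ideal cuts an initial interval out of it; the two covers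
  across segments then yield the side conditions in \<open>states\<close>.\<close>

lemma ideal_of_image:
  assumes "0 < a"
  shows "ideal_of a ` states a = ideals (fence a)"
proof
  show "ideal_of a ` states a \<subseteq> ideals (fence a)"
    using assms by (auto simp del: ideal_of.simps intro: ideal_of_in_ideals)
  show "ideals (fence a) \<subseteq> ideal_of a ` states a"
  proof
    fix J assume J: "J \<in> ideals (fence a)"
    then have sub: "J \<subseteq> {1..3 * a + 1}" and down: "\<And>x y. x \<in> J \<Longrightarrow> (y, x) \<in> fence a \<Longrightarrow> y \<in> J"
      unfolding ideals_def Field_fence by blast+
    have "\<exists>p\<le>a. J \<inter> {0<..a} = {0<..0 + p}"
      by (rule downset_of_interval) (auto intro: down simp: fence_iff_segment assms)
    then obtain p where p: "p \<le> a" "J \<inter> {0<..a} = {0<..p}" by auto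
    have "\<exists>q\<le>a + 1. J \<inter> {a<..2 * a + 1} = {a<..a + q}"
      by (rule downset_of_interval) (auto intro: down simp: fence_iff_segment assms)
    then obtain q where q: "q \<le> a + 1" "J \<inter> {a<..2 * a + 1} = {a<..a + q}" by auto
    have "\<exists>r\<le>a. J \<inter> {2 * a + 1<..3 * a + 1} = {2 * a + 1<..2 * a + 1 + r}"
      by (rule downset_of_interval) (auto intro: down simp: fence_iff_segment assms)
    then obtain r where r: "r \<le> a" "J \<inter> {2 * a + 1<..3 * a + 1} = {2 * a + 1<..2 * a + 1 + r}"
      by auto
    have "{1..3 * a + 1} = {0<..a} \<union> {a<..2 * a + 1} \<union> {2 * a + 1<..3 * a + 1}"
      by auto
    then have "J = J \<inter> {0<..a} \<union> J \<inter> {a<..2 * a + 1} \<union> J \<inter> {2 * a + 1<..3 * a + 1}"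
      using sub by blast
    then have Jeq: "J = ideal_of a (p, q, r)" using p q r by simp
    have "0 < q" if "p = a"
    proof -
      have "a \<in> J" using that assms by (simp add: Jeq)
      then have "a + 1 \<in> J" by (rule down) (simp add: fence_iff_segment assms)
      then have "a + 1 \<in> J \<inter> {a<..2 * a + 1}" by simp
      then show ?thesis unfolding q(2) by simp
    qed
    moreover have "0 < r" if "q = a + 1"
    proof -
      have "2 * a + 1 \<in> J" using that assms by (simp add: Jeq)
      then have "2 * a + 2 \<in> J" by (rule down) (simp add: fence_iff_segment assms)
      then have "2 * a + 2 \<in> J \<inter> {2 * a + 1<..3 * a + 1}" using assms by simp
      then show ?thesis unfolding r(2) by simp
    qed
    ultimately have "(p, q, r) \<in> states a" using p q r by (simp add: states_def)
    then show "J \<in> ideal_of a ` states a" using Jeq by blast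
  qed
qed

lemma inj_on_ideal_of: "inj_on (ideal_of a) (states a)"
proof (rule inj_onI)
  fix s t assume st: "s \<in> states a" "t \<in> states a" "ideal_of a s = ideal_of a t"
  obtain p q r p' q' r' where *: "s = (p, q, r)" "t = (p', q', r')" by (metis prod_cases3)
  have D: "ideal_of a (p, q, r) \<inter> {0<..a} = {0<..p} \<and>
    ideal_of a (p, q, r) \<inter> {a<..2 * a + 1} = {a<..a + q} \<and>
    ideal_of a (p, q, r) \<inter> {2 * a + 1<..3 * a + 1} = {2 * a + 1<..2 * a + 1 + r}"
    if "(p, q, r) \<in> states a" for p q r
    using that by (auto simp: states_def)
  have "card {0<..p} = card {0<..p'} \<and> card {a<..a + q} = card {a<..a + q'} \<and>
    card {2 * a + 1<..2 * a + 1 + r} = card {2 * a + 1<..2 * a + 1 + r'}"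
    using D[of p q r] D[of p' q' r'] st * by metis
  then show "s = t" using * by simp
qed

lemma ideal_generated_antichain_of:
  assumes "0 < a" and "t \<in> states a"
  shows "ideal_generated (fence a) (antichain_of a t) = ideal_of a t"
proof -
  obtain p q r where t: "t = (p, q, r)" by (metis prod_cases3)
  have pqr: "p \<le> a" "q \<le> a + 1" "r \<le> a" "p = a \<Longrightarrow> 0 < q" "q = a + 1 \<Longrightarrow> 0 < r"
    using assms(2) by (auto simp: t states_def)
  have "(\<exists>y\<in>antichain_of a t. (x, y) \<in> fence a) \<longleftrightarrow>
    0 < p \<and> (x, p) \<in> fence a \<or> \<not> (q = 0 \<or> q = 1 \<and> p = a) \<and> (x, a + q) \<in> fence a \<or>
    \<not> (r = 0 \<or> r = 1 \<and> q = a + 1) \<and> (x, 2 * a + 1 + r) \<in> fence a" for x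
    by (auto simp: t)
  also have "\<dots> x \<longleftrightarrow> x \<in> ideal_of a t" for x
    using assms(1) pqr mem_ideal_of_segment[OF assms(2)[unfolded t]] unfolding t
    by (cases x a rule: segment_cases) (auto simp: fence_iff_segment simp del: ideal_of.simps)
  finally show ?thesis by (auto simp: ideal_generated_def simp del: ideal_of.simps antichain_of.simps)
qed

lemma antichain_of_in_antichains:
  assumes "0 < a" and "t \<in> states a"
  shows "antichain_of a t \<in> antichains (fence a)"
proof -
  obtain p q r where t: "t = (p, q, r)" by (metis prod_cases3)
  have pqr: "p \<le> a" "q \<le> a + 1" "r \<le> a" "p = a \<Longrightarrow> 0 < q" "q = a + 1 \<Longrightarrow> 0 < r"
    using assms(2) by (auto simp: t states_def)
  note mem = mem_antichain_of_segment[OF assms(2)[unfolded t]]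
  have "x = y" if "x \<in> antichain_of a t" "y \<in> antichain_of a t" "(x, y) \<in> fence a" for x y
    using that assms pqr unfolding t
    by (cases x a rule: segment_cases; cases y a rule: segment_cases)
       (auto simp: mem fence_iff_segment simp del: antichain_of.simps)
  moreover have "antichain_of a t \<subseteq> Field (fence a)"
    using pqr by (auto simp: t Field_fence)
  ultimately show ?thesis by (auto simp: antichains_def simp del: antichain_of.simps)
qed

text \<open>Only the lowest missing element of a segment can be minimal outside the ideal, and it is
  unless it is a blocked top.\<close>

lemma minimal_elements_ideal_of:
  assumes a: "2 \<le> a" and st: "t \<in> states a"
  shows "minimal_elements (fence a) (Field (fence a) - ideal_of a t) = antichain_of a (step a t)"
    (is "?L = ?R")
proof -
  obtain p q r where t: "t = (p, q, r)" by (metis prod_cases3)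
  have pqr: "p \<le> a" "q \<le> a + 1" "r \<le> a" "p = a \<Longrightarrow> 0 < q" "q = a + 1 \<Longrightarrow> 0 < r"
    using assms(2) by (auto simp: t states_def)
  note mem = mem_ideal_of_segment[OF st[unfolded t]]
  have a0: "0 < a" using a by simp
  have "y \<in> {1..3 * a + 1}" if "(y, x) \<in> fence a" for x y
    using that by (auto simp: fence_def)
  then have L: "x \<in> ?L \<longleftrightarrow> x \<in> {1..3 * a + 1} - ideal_of a t \<and>
    (\<forall>y. (y, x) \<in> fence a \<longrightarrow> y \<in> ideal_of a t \<or> y = x)" for x
    unfolding minimal_elements_def Field_fence by blast
  let ?cov = "\<lambda>x. x = p + 1 \<and> (p + 1 < a \<or> p + 1 = a \<and> 0 < q) \<or>
    x = a + q + 1 \<and> (q < a \<or> q = a \<and> 0 < r) \<or> x = 2 * a + 2 + r \<and> r < a"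
  have "x \<in> ?L \<longleftrightarrow> ?cov x" for x
  proof
    assume "x \<in> ?L"
    then have x: "1 \<le> x" "x \<le> 3 * a + 1" "x \<notin> ideal_of a t"
      and y: "\<And>y. (y, x) \<in> fence a \<Longrightarrow> y \<in> ideal_of a t \<or> y = x" using L by auto
    show "?cov x"
    proof (cases x a rule: segment_cases)
      case low
      \<comment> \<open>Minimality against \<open>p + 1\<close>, the lowest missing element, forces
        \<open>x = p + 1\<close>; \<open>a + 1\<close> is the only element of another segment below
        x_a and detects blocking.\<close>
      then show ?thesis using x y[of "p + 1"] y[of "a + 1"] a pqr unfolding t
        by (auto simp: mem fence_iff_segment[OF a0] simp del: ideal_of.simps)
    next
      case mid
      then show ?thesis using x y[of "a + q + 1"] y[of "2 * a + 2"] a pqr unfolding t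
        by (auto simp: mem fence_iff_segment[OF a0] simp del: ideal_of.simps)
    next
      case high
      then show ?thesis using x y[of "2 * a + 2 + r"] a pqr unfolding t
        by (auto simp: mem fence_iff_segment[OF a0] simp del: ideal_of.simps)
    qed
  next
    assume x: "?cov x"
    have "x \<in> {1..3 * a + 1} - ideal_of a t"
      using x a pqr unfolding t
      by (cases x a rule: segment_cases) (auto simp: mem simp del: ideal_of.simps)
    moreover have "y \<in> ideal_of a t \<or> y = x" if "(y, x) \<in> fence a" for y
      using that x a pqr unfolding t
      by (cases y a rule: segment_cases)
         (auto simp: mem fence_iff_segment[OF a0] simp del: ideal_of.simps)
    ultimately show "x \<in> ?L" using L by blast
  qed
  moreover have "x \<in> ?R \<longleftrightarrow> ?cov x" for x
    using a pqr by (auto simp: t)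
  ultimately show ?thesis by blast
qed

section \<open>Rowmotion and ideal complement on triples\<close>

lemma rowmotion_antichain_of:
  assumes "2 \<le> a" and "t \<in> states a"
  shows "rowmotion (fence a) (antichain_of a t) = antichain_of a (step a t)"
  using assms by (simp add: rowmotion_def ideal_generated_antichain_of minimal_elements_ideal_of)

lemma step_in_states: "2 \<le> a \<Longrightarrow> t \<in> states a \<Longrightarrow> step a t \<in> states a"
  by (cases t) (auto simp: states_def)

lemma dual_in_states: "t \<in> states a \<Longrightarrow> dual a t \<in> states a"
  by (cases t) (auto simp: states_def)

lemma dual_dual: "t \<in> states a \<Longrightarrow> dual a (dual a t) = t"
  by (cases t) (auto simp: states_def)

text \<open>Complementation turns minimal elements outside an ideal into maximal elements inside the
  complement, so it conjugates rowmotion to its inverse; the proof checks this at the boundary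
  values of the coordinates.\<close>

lemma step_dual_step:
  assumes "2 \<le> a" and "t \<in> states a"
  shows "step a (dual a (step a t)) = dual a t"
proof -
  obtain p q r where t: "t = (p, q, r)" by (metis prod_cases3)
  have pqr: "p \<le> a" "q \<le> a + 1" "r \<le> a" "p = a \<Longrightarrow> 0 < q" "q = a + 1 \<Longrightarrow> 0 < r"
    using assms(2) by (auto simp: t states_def)
  have "p + 1 < a \<or> p + 1 = a \<or> p = a" "q = 0 \<or> 0 < q \<and> q < a \<or> q = a \<or> q = a + 1"
    "r = 0 \<or> 0 < r \<and> r < a \<or> r = a"
    using pqr by linarith+
  then show ?thesis
    using assms(1) pqr by (elim disjE conjE) (auto simp: t)
qed

text \<open>The reversal identity supplies the inverse: \<open>step a\<close> conjugated by the
  involution \<open>dual a\<close>.\<close>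

lemma bij_betw_step:
  assumes "2 \<le> a"
  shows "bij_betw (step a) (states a) (states a)"
proof (rule bij_betw_byWitness)
  let ?g = "\<lambda>t. dual a (step a (dual a t))"
  show "\<forall>t\<in>states a. ?g (step a t) = t"
    using assms step_dual_step dual_dual by simp
  show "\<forall>t\<in>states a. step a (?g t) = t"
    using assms step_dual_step dual_dual dual_in_states by metis
  show "step a ` states a \<subseteq> states a" "?g ` states a \<subseteq> states a"
    using assms step_in_states dual_in_states by blast+
qed

lemma bij_betw_dual: "bij_betw (dual a) (states a) (states a)"
proof (rule bij_betw_byWitness)
  show "\<forall>t\<in>states a. dual a (dual a t) = t" "\<forall>t\<in>states a. dual a (dual a t) = t"
    using dual_dual by blast+
  show "dual a ` states a \<subseteq> states a" "dual a ` states a \<subseteq> states a"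
    using dual_in_states by blast+
qed

lemma ideal_rowmotion_ideal_of:
  assumes "2 \<le> a" and "t \<in> states a"
  shows "ideal_rowmotion (fence a) (ideal_of a t) = ideal_of a (step a t)"
  using assms
  by (simp add: ideal_rowmotion_def minimal_elements_ideal_of ideal_generated_antichain_of
      step_in_states)

lemma ideal_complement_ideal_of:
  assumes "t \<in> states a"
  shows "ideal_complement a (ideal_of a t) = ideal_of a (dual a t)"
proof -
  obtain p q r where t: "t = (p, q, r)" by (metis prod_cases3)
  have pqr: "p \<le> a" "q \<le> a + 1" "r \<le> a" using assms by (auto simp: t states_def)
  have "x \<in> ideal_complement a (ideal_of a t) \<longleftrightarrow>
    x \<in> {1..3 * a + 1} \<and> 3 * a + 2 - x \<notin> ideal_of a t" for x
    unfolding ideal_complement_def fence_dual_def Field_fence image_iff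
    by (force intro: bexI[of _ "3 * a + 2 - x"])
  also have "\<dots> x \<longleftrightarrow> x \<in> ideal_of a (dual a t)" for x
    using pqr unfolding t dual.simps by (cases x a rule: segment_cases) auto
  finally show ?thesis by blast
qed

section \<open>Antichains versus the ideals they generate, and transfer of orbits\<close>

lemma inj_on_ideal_generated:
  assumes "partial_order_on (Field r) r"
  shows "inj_on (ideal_generated r) (antichains r)"
proof -
  have "A \<subseteq> B" if AB: "A \<in> antichains r" "ideal_generated r A = ideal_generated r B" for A B
  proof
    fix x assume x: "x \<in> A"
    have refl: "refl_on (Field r) r" and "trans r" "antisym r"
      using assms by (auto simp: partial_order_on_def preorder_on_def)
    have "(x, x) \<in> r" using x AB refl by (auto simp: antichains_def refl_on_def)
    then have "x \<in> ideal_generated r B" using x AB by (auto simp: ideal_generated_def)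
    then obtain y where y: "y \<in> B" "(x, y) \<in> r" by (auto simp: ideal_generated_def)
    have "(y, y) \<in> r" using y refl by (auto simp: Field_def refl_on_def)
    then have "y \<in> ideal_generated r A" using y AB by (auto simp: ideal_generated_def)
    then obtain z where z: "z \<in> A" "(y, z) \<in> r" by (auto simp: ideal_generated_def)
    have "(x, z) \<in> r" using y z \<open>trans r\<close> by (auto dest: transD)
    then have "x = z" using AB x z by (auto simp: antichains_def)
    then have "x = y" using y z \<open>antisym r\<close> by (auto dest: antisymD)
    with y show "x \<in> B" by simp
  qed
  then show ?thesis by (intro inj_onI equalityI) auto
qed

lemma ideal_generated_in_ideals:
  assumes "trans r"
  shows "ideal_generated r A \<in> ideals r"
  using assms by (auto simp: ideals_def ideal_generated_def Field_def dest: transD)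

text \<open>Surjectivity is inherited from ideals: the ideal of \<open>A\<close> has coordinates
  \<open>t\<close>, and an antichain is determined by its ideal.\<close>

lemma antichain_of_image:
  assumes "2 \<le> a"
  shows "antichain_of a ` states a = antichains (fence a)"
proof
  show "antichain_of a ` states a \<subseteq> antichains (fence a)"
    using assms by (auto intro: antichain_of_in_antichains)
  show "antichains (fence a) \<subseteq> antichain_of a ` states a"
  proof
    fix A assume A: "A \<in> antichains (fence a)"
    have po: "partial_order_on (Field (fence a)) (fence a)"
      using assms by (rule partial_order_on_fence)
    then have "ideal_generated (fence a) A \<in> ideals (fence a)"
      by (intro ideal_generated_in_ideals) (auto simp: partial_order_on_def preorder_on_def)
    then obtain t where t: "t \<in> states a" "ideal_generated (fence a) A = ideal_of a t"
      using assms by (auto simp flip: ideal_of_image)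
    then have "ideal_generated (fence a) A = ideal_generated (fence a) (antichain_of a t)"
      using assms by (simp add: ideal_generated_antichain_of)
    then have "A = antichain_of a t"
      using inj_on_ideal_generated[OF po] A antichain_of_in_antichains[of a t] t assms
      by (auto simp: inj_on_def)
    then show "A \<in> antichain_of a ` states a" using t by blast
  qed
qed

lemma inj_on_antichain_of: "0 < a \<Longrightarrow> inj_on (antichain_of a) (states a)"
  by (rule inj_onI) (metis ideal_generated_antichain_of inj_on_ideal_of inj_onD)

lemma rowmotion_orbits_fence:
  assumes "2 \<le> a"
  shows "rowmotion_orbits (fence a) = (`) (antichain_of a) ` generated_orbits (states a) {step a}"
  unfolding rowmotion_orbits_def antichain_of_image[OF assms, symmetric]
proof (rule generated_orbits_conjugate)
  show "inj_on (antichain_of a) (states a)" using assms by (simp add: inj_on_antichain_of)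
qed (use assms finite_states bij_betw_step rowmotion_antichain_of in blast)+

lemma dihedral_orbits_fence:
  assumes "2 \<le> a"
  shows "dihedral_orbits a = (`) (ideal_of a) ` generated_orbits (states a) {step a, dual a}"
proof -
  have "ideal_of a ` states a = ideals (fence a)"
    using assms by (simp add: ideal_of_image)
  moreover have "generated_orbits (ideal_of a ` states a)
      {ideal_rowmotion (fence a), ideal_complement a} =
    (`) (ideal_of a) ` generated_orbits (states a) {step a, dual a}"
  proof (rule generated_orbits_conjugate[OF finite_states inj_on_ideal_of])
    show "bij_betw f (states a) (states a)" if "f \<in> {step a, dual a}" for f
      using that assms bij_betw_step bij_betw_dual by blast
  qed (use assms ideal_rowmotion_ideal_of ideal_complement_ideal_of in auto)
  ultimately show ?thesis by (simp add: dihedral_orbits_def)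
qed

section \<open>Runs between visits to the cross-section\<close>

text \<open>The second clause is a fall-back to 1: \<open>p = a\<close> is reached only if
  \<open>0 < q\<close> beforehand, so \<open>q = 1\<close> did not rise from 0 but comes from
  x_{a+1} being regenerated below x_a.\<close>

definition cross_section :: "nat \<Rightarrow> state set" where
  "cross_section a = {(p, q, r) \<in> states a. q = 0 \<or> q = 1 \<and> p = a}"

text \<open>Reduction modulo \<open>a + 1\<close>; one subtraction suffices, as the arguments within
  a run are at most \<open>2 * a + 1\<close>.\<close>

definition wrap :: "nat \<Rightarrow> nat \<Rightarrow> nat" where
  "wrap a n = (if n \<le> a then n else n - (a + 1))"

text \<open>\<open>traj a t k\<close> is the state \<open>k\<close> steps after \<open>t \<in> cross_section a\<close>, valid for
  \<open>k < period a t\<close>. From \<open>p = a - 1\<close>, \<open>q = 0\<close> the first coordinate falls back one step early, since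
  $x_a$ is blocked by $x_{a+1}$; and the last one restarts at 1 when $x_{2a+1}$ is added.\<close>

fun traj :: "nat \<Rightarrow> state \<Rightarrow> nat \<Rightarrow> state" where
  "traj a (p, q, r) k =
    (wrap a ((if q = 0 \<and> p + 1 = a \<and> 0 < k then a else p) + k),
     q + k,
     if q + k = a + 1 \<and> wrap a (r + k) = 0 then 1 else wrap a (r + k))"

text \<open>After \<open>a - q\<close> steps the second coordinate is \<open>a\<close> and the third
  is \<open>wrap a (r + a - q)\<close>. If the latter is 0, that is \<open>r = q + 1\<close>, then
  x_{2a+1} is blocked and the run ends one step earlier.\<close>

fun period :: "nat \<Rightarrow> state \<Rightarrow> nat" where
  "period a (p, q, r) = a + (if r = q + 1 then 1 else 2) - q"

text \<open>\<open>p\<close> and \<open>r\<close> move by the run length modulo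
  \<open>a + 1\<close>, plus one for an early fall-back of \<open>p\<close> (from
  \<open>p = a - 1\<close>, \<open>q = 0\<close>) or a restart of \<open>r\<close> at 1 (from
  \<open>r = q\<close>).\<close>

fun ret :: "nat \<Rightarrow> state \<Rightarrow> state" where
  "ret a (p, q, r) =
    (if q = 0 then
       if r = 1 then (if p + 1 = a then (a, 1, 1) else (p, 0, 1))
       else (if p + 1 = a then 0 else p + 1, 0, if r = 0 then 2 else if r = a then 0 else r + 1)
     else if r = 1 then (a, 1, 2) else if r = 2 then (a - 1, 0, 1) else (a, 1, r))"

lemma cross_section_cases:
  assumes "t \<in> cross_section a"
  obtains (low) p r where "t = (p, 0, r)" "p < a" "r \<le> a" | (high) s where "t = (a, 1, s)" "s \<le> a"
  using assms by (auto simp: cross_section_def states_def le_less)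

lemma cross_section_subset: "cross_section a \<subseteq> states a"
  by (auto simp: cross_section_def)

lemma step_traj_low:
  assumes a: "2 \<le> a" and t: "t = (p, 0, r)" "p < a" "r \<le> a" and k: "k < period a t"
  shows "step a (traj a t k) = (if Suc k = period a t then ret a t else traj a t (Suc k))"
proof -
  obtain P Q R where X: "traj a t k = (P, Q, R)" by (metis prod_cases3)
  obtain P' Q' R' where Y: "(if Suc k = period a t then ret a t else traj a t (Suc k)) = (P', Q', R')"
    by (metis prod_cases3)
  have kr: "k \<le> a \<or> k = a + 1 \<and> r \<noteq> 1" using k t by (auto split: if_splits)
  have last: "Suc k = period a t \<longleftrightarrow> k = a + 1 \<or> k = a \<and> r = 1" using kr t by auto
  have Q: "Q = k" using X t by simp
  have P: "P = wrap a (if p + 1 = a \<and> 0 < k then a + k else p + k)"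
    using X t by auto
  \<comment> \<open>The restart at 1 needs \<open>r + k = a + 1\<close> at the moment
    \<open>k = a + 1\<close>, hence \<open>r = 0\<close>.\<close>
  have R: "R = (if k = a + 1 \<and> r = 0 then 1 else wrap a (r + k))"
    using X t kr by (auto simp: wrap_def split: if_splits)
  have YP: "P' = (if k = a + 1 \<or> k = a \<and> r = 1
      then if r = 1 then if p + 1 = a then a else p else if p + 1 = a then 0 else p + 1
      else wrap a (if p + 1 = a then a + Suc k else p + Suc k))"
    and YQ: "Q' = (if k = a + 1 \<or> k = a \<and> r = 1
      then if r = 1 \<and> p + 1 = a then 1 else 0 else Suc k)"
    and YR: "R' = (if k = a + 1 \<or> k = a \<and> r = 1
      then if r = 1 then 1 else if r = 0 then 2 else if r = a then 0 else r + 1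
      else if k = a \<and> wrap a (r + Suc k) = 0 then 1 else wrap a (r + Suc k))"
    using Y unfolding last by (auto simp: t split: if_splits)
  have P1: "P' = (if P + 1 < a \<or> P + 1 = a \<and> 0 < Q then P + 1 else 0)"
  proof (cases "p + 1 = a")
    \<comment> \<open>The first step is blocked here, which puts all later values of the first
      coordinate ahead by one.\<close>
    case True
    then have "k = 0 \<or> k = 1 \<or> 1 < k \<and> k < a \<or> k = a \<or> k = a + 1" using kr by linarith
    then show ?thesis using YP t True a P Q kr by (elim disjE) (auto simp: wrap_def)
  next
    case False
    then have "p + k + 1 < a \<or> p + k + 1 = a \<or> p + k = a \<or> p + k = a + 1 \<or> p + k > a + 1"
      by linarith
    then show ?thesis using YP t False a P Q kr
      by (elim disjE; cases "r = 1") (auto simp: wrap_def)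
  qed
  moreover have "Q' = (if Q < a \<or> Q = a \<and> 0 < R then Q + 1 else if P + 1 = a then 1 else 0)"
  proof -
    have "k < a \<or> k = a \<or> k = a + 1" using kr by linarith
    then show ?thesis using YQ t a P Q R kr
      by (elim disjE; cases "r = 1"; cases "p + 1 = a") (auto simp: wrap_def)
  qed
  moreover have "R' = (if R < a then R + 1 else if Q = a then 1 else 0)"
  proof -
    have "r + k < a \<or> r + k = a \<or> r + k = a + 1 \<or> r + k > a + 1" by linarith
    moreover have "k < a \<or> k = a \<or> k = a + 1" using kr by linarith
    moreover have "r = 0 \<or> r = 1 \<or> r = a \<or> 1 < r \<and> r < a" using t(3) by linarith
    ultimately show ?thesis using YR t a Q R kr
      by (elim disjE) (auto simp: wrap_def)
  qed
  ultimately show ?thesis unfolding X Y by simp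
qed

lemma step_traj_high:
  assumes a: "2 \<le> a" and t: "t = (a, 1, s)" "s \<le> a" and k: "k < period a t"
  shows "step a (traj a t k) = (if Suc k = period a t then ret a t else traj a t (Suc k))"
proof -
  obtain P Q R where X: "traj a t k = (P, Q, R)" by (metis prod_cases3)
  obtain P' Q' R' where Y: "(if Suc k = period a t then ret a t else traj a t (Suc k)) = (P', Q', R')"
    by (metis prod_cases3)
  have ks: "k < a \<or> k = a \<and> s \<noteq> 2" using k t a by (auto split: if_splits)
  have last: "Suc k = period a t \<longleftrightarrow> k = a \<or> k + 1 = a \<and> s = 2" using ks t a by auto
  have Q: "Q = k + 1" using X t by simp
  have P: "P = wrap a (a + k)" using X t by auto
  have R: "R = (if k = a \<and> s = 1 then 1 else wrap a (s + k))"
    using X t ks a by (auto simp: wrap_def split: if_splits)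
  have YP: "P' = (if k = a \<or> k + 1 = a \<and> s = 2
      then if s = 2 then a - 1 else a else wrap a (a + Suc k))"
    and YQ: "Q' = (if k = a \<or> k + 1 = a \<and> s = 2
      then if s = 2 then 0 else 1 else Suc (Suc k))"
    and YR: "R' = (if k = a \<or> k + 1 = a \<and> s = 2
      then if s = 1 then 2 else if s = 2 then 1 else s
      else if k + 1 = a \<and> wrap a (s + Suc k) = 0 then 1 else wrap a (s + Suc k))"
    using Y unfolding last by (auto simp: t split: if_splits)
  have k': "k = 0 \<or> 0 < k \<and> k + 1 < a \<or> k + 1 = a \<or> k = a" using ks by linarith
  have "P' = (if P + 1 < a \<or> P + 1 = a \<and> 0 < Q then P + 1 else 0)"
    using k' YP t a P Q ks
    by (elim disjE; cases "s = 2"; cases "s = 1") (auto simp: wrap_def)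
  moreover have "Q' = (if Q < a \<or> Q = a \<and> 0 < R then Q + 1 else if P + 1 = a then 1 else 0)"
    using k' YQ t a P Q R ks
    by (elim disjE; cases "s = 2"; cases "s = 1") (auto simp: wrap_def)
  moreover have "R' = (if R < a then R + 1 else if Q = a then 1 else 0)"
  proof -
    have "s + k < a \<or> s + k = a \<or> s + k = a + 1 \<or> s + k > a + 1" by linarith
    moreover have "s = 0 \<or> s = 1 \<or> s = 2 \<or> 2 < s \<and> s < a \<or> s = a" using t(2) by linarith
    ultimately show ?thesis using k' YR t a Q R ks
      by (elim disjE) (auto simp: wrap_def)
  qed
  ultimately show ?thesis unfolding X Y by simp
qed

lemma step_traj:
  assumes "2 \<le> a" and "t \<in> cross_section a" and "k < period a t"
  shows "step a (traj a t k) = (if Suc k = period a t then ret a t else traj a t (Suc k))"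
  using assms(2)
proof (cases rule: cross_section_cases)
  case (low p r)
  then show ?thesis using assms by (intro step_traj_low)
next
  case (high s)
  then show ?thesis using assms by (intro step_traj_high)
qed

lemma period_pos: "t \<in> cross_section a \<Longrightarrow> 0 < period a t"
  by (auto simp: cross_section_def states_def split: if_splits)

lemma traj_0: "t \<in> cross_section a \<Longrightarrow> traj a t 0 = t"
  by (auto simp: cross_section_def states_def wrap_def split: if_splits)

lemma funpow_step:
  assumes "2 \<le> a" and "t \<in> cross_section a"
  shows "k < period a t \<Longrightarrow> (step a ^^ k) t = traj a t k"
proof (induction k)
  case 0
  then show ?case using assms traj_0 by simp
next
  case (Suc k)
  then show ?case using step_traj[OF assms, of k] by simp
qed

lemma funpow_step_period:
  assumes "2 \<le> a" and "t \<in> cross_section a"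
  shows "(step a ^^ period a t) t = ret a t"
proof -
  obtain k where k: "period a t = Suc k"
    using period_pos[OF assms(2)] gr0_implies_Suc by blast
  then show ?thesis using funpow_step[OF assms, of k] step_traj[OF assms, of k] by simp
qed

lemma ret_in_cross_section:
  assumes "2 \<le> a" and "t \<in> cross_section a"
  shows "ret a t \<in> cross_section a"
  using assms(2)
proof (cases rule: cross_section_cases)
  case (low p r)
  then show ?thesis using assms(1) by (auto simp: cross_section_def states_def)
next
  case (high s)
  then show ?thesis using assms(1) by (auto simp: cross_section_def states_def)
qed

lemma traj_notin_cross_section:
  assumes "t \<in> cross_section a" and "0 < k" and "k < period a t"
  shows "traj a t k \<notin> cross_section a"
  using assms(1)
proof (cases rule: cross_section_cases)
  case (low p r)
  then show ?thesis using assms(2,3) by (auto simp: cross_section_def wrap_def split: if_splits)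
next
  case (high s)
  then show ?thesis using assms(2,3) by (auto simp: cross_section_def wrap_def split: if_splits)
qed

text \<open>A step either raises \<open>q\<close>, which is bounded by \<open>a + 1\<close>, or
  makes it fall back and so lands in the cross-section.\<close>

lemma reaches_cross_section:
  assumes "2 \<le> a" and "t \<in> states a"
  shows "\<exists>k. (step a ^^ k) t \<in> cross_section a"
  using assms(2)
proof (induction "a + 1 - fst (snd t)" arbitrary: t rule: less_induct)
  case less
  obtain p q r where t: "t = (p, q, r)" by (metis prod_cases3)
  have S: "step a t \<in> states a" using assms(1) less(2) by (rule step_in_states)
  show ?case
  proof (cases "step a t \<in> cross_section a")
    case True
    then show ?thesis by (intro exI[of _ 1]) simp
  next
    case False
    have "q < a \<or> q = a \<and> 0 < r \<or> q = a \<and> r = 0 \<or> q = a + 1"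
      using less(2) by (auto simp: t states_def)
    then have "q < a \<or> q = a \<and> 0 < r"
      using False S assms(1) by (elim disjE) (auto simp: t cross_section_def split: if_splits)
    then have "a + 1 - fst (snd (step a t)) < a + 1 - fst (snd t)"
      by (auto simp: t)
    then obtain k where "(step a ^^ k) (step a t) \<in> cross_section a"
      using less(1) S by blast
    then have "(step a ^^ Suc k) t \<in> cross_section a"
      by (simp add: funpow_swap1)
    then show ?thesis by blast
  qed
qed

lemma first_return_step:
  assumes "2 \<le> a"
  shows "first_return (step a) (states a) (cross_section a) (period a)"
proof
  show "finite (states a)" by (rule finite_states)
  show "bij_betw (step a) (states a) (states a)" using assms by (rule bij_betw_step)
  show "cross_section a \<subseteq> states a" by (rule cross_section_subset)
qed (use assms in \<open>auto simp: period_pos funpow_step_period ret_in_cross_section funpow_step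
    traj_notin_cross_section reaches_cross_section simp del: period.simps ret.simps traj.simps\<close>)

section \<open>Sizes of antichains along runs\<close>

fun weight :: "nat \<Rightarrow> state \<Rightarrow> nat" where
  "weight a (p, q, r) = of_bool (p \<noteq> 0) + of_bool (\<not> (q = 0 \<or> q = 1 \<and> p = a)) +
     of_bool (\<not> (r = 0 \<or> r = 1 \<and> q = a + 1))"

lemma card_antichain_of:
  assumes "0 < a" and "t \<in> states a"
  shows "card (antichain_of a t) = weight a t"
proof -
  obtain p q r where t: "t = (p, q, r)" by (metis prod_cases3)
  have "p \<le> a" "q \<le> a + 1" using assms(2) by (auto simp: t states_def)
  then show ?thesis by (auto simp: t)
qed

text \<open>Kept additive so that no truncated subtraction enters the later counts.\<close>

lemma sum_of_bool_not:
  "(\<Sum>k<n. of_bool (\<not> P k)) + card {k. k < n \<and> P k} = (n::nat)"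
proof -
  have "card {k. k < n \<and> P k} = (\<Sum>k<n. of_bool (P k))"
    by (simp add: sum_of_bool_eq Int_def)
  then have "(\<Sum>k<n. of_bool (\<not> P k)) + card {k. k < n \<and> P k} =
      (\<Sum>k<n. of_bool (\<not> P k) + of_bool (P k))"
    by (simp only: sum.distrib)
  also have "\<dots> = (\<Sum>k<n. 1)" by (intro sum.cong) auto
  finally show ?thesis by simp
qed

text \<open>The antichain misses each segment once per run, which gives the 3. A run of length
  \<open>a + 2\<close> exceeds the period \<open>a + 1\<close> of \<open>p\<close> and
  \<open>r\<close> by one, so if one of them is 0 at the start, its segment is missed again at the
  last time \<open>a + 1\<close>.\<close>

lemma sum_weight_run:
  assumes a: "2 \<le> a" and t: "t \<in> cross_section a"
  shows "(\<Sum>k<period a t. weight a (traj a t k)) + 3 +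
    (case t of (p, q, r) \<Rightarrow> if q = 0 \<and> r \<noteq> 1 then of_bool (p = 0) + of_bool (r = 0) else 0) =
    3 * period a t"
proof -
  let ?n = "period a t"
  let ?p = "\<lambda>k. fst (traj a t k)"
  let ?q = "\<lambda>k. fst (snd (traj a t k))"
  let ?r = "\<lambda>k. snd (snd (traj a t k))"
  let ?Z1 = "{k. k < ?n \<and> ?p k = 0}"
  let ?Z2 = "{k. k < ?n \<and> (?q k = 0 \<or> ?q k = 1 \<and> ?p k = a)}"
  let ?Z3 = "{k. k < ?n \<and> (?r k = 0 \<or> ?r k = 1 \<and> ?q k = a + 1)}"
  have w: "weight a x = of_bool (\<not> fst x = 0) +
      of_bool (\<not> (fst (snd x) = 0 \<or> fst (snd x) = 1 \<and> fst x = a)) +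
      of_bool (\<not> (snd (snd x) = 0 \<or> snd (snd x) = 1 \<and> fst (snd x) = a + 1))" for x
    by (cases x) simp
  have total: "(\<Sum>k<?n. weight a (traj a t k)) + card ?Z1 + card ?Z2 + card ?Z3 = 3 * ?n"
    unfolding w sum.distrib
    using sum_of_bool_not[of "\<lambda>k. ?p k = 0" ?n]
      sum_of_bool_not[of "\<lambda>k. ?q k = 0 \<or> ?q k = 1 \<and> ?p k = a" ?n]
      sum_of_bool_not[of "\<lambda>k. ?r k = 0 \<or> ?r k = 1 \<and> ?q k = a + 1" ?n]
    by linarith
  show ?thesis
    using t
  proof (cases rule: cross_section_cases)
    case (low p r)
    have n: "k < ?n \<longleftrightarrow> k \<le> a \<or> k = a + 1 \<and> r \<noteq> 1" for k using low by auto
    let ?e = "if r \<noteq> 1 then of_bool (p = 0) + of_bool (r = 0) else 0 :: nat"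
    have "?Z1 = (if p = 0 \<and> r \<noteq> 1 then {0, a + 1}
        else {if p = 0 then 0 else if p + 1 = a then 1 else a + 1 - p})"
      using a low unfolding n by (auto simp: wrap_def split: if_splits)
    then have "card ?Z1 = 1 + of_bool (p = 0 \<and> r \<noteq> 1)" by auto
    moreover have "?Z2 = {0}"
      using a low unfolding n by (auto simp: wrap_def split: if_splits)
    then have "card ?Z2 = 1" by simp
    moreover have "?Z3 = (if r = 0 then {0, a + 1} else {a + 1 - r})"
      using a low unfolding n by (auto simp: wrap_def split: if_splits)
    then have "card ?Z3 = 1 + of_bool (r = 0)" by auto
    ultimately have "card ?Z1 + card ?Z2 + card ?Z3 = 3 + ?e"
      by (simp del: One_nat_def)
    with total have "(\<Sum>k<?n. weight a (traj a t k)) + 3 + ?e = 3 * ?n" by linarith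
    then show ?thesis by (simp only: low prod.case simp_thms if_True)
  next
    case (high s)
    have n: "k < ?n \<longleftrightarrow> k < a \<or> k = a \<and> s \<noteq> 2" for k using high a by auto
    have "?Z1 = {1}"
      using a high unfolding n by (auto simp: wrap_def split: if_splits)
    then have "card ?Z1 = 1" by simp
    moreover have "?Z2 = {0}"
      using a high unfolding n by (auto simp: wrap_def split: if_splits)
    then have "card ?Z2 = 1" by simp
    moreover have "?Z3 = {if s = 0 then 0 else a + 1 - s}"
      using a high unfolding n by (auto simp: wrap_def split: if_splits)
    then have "card ?Z3 = 1" by simp
    ultimately have "(\<Sum>k<?n. weight a (traj a t k)) + 3 + 0 = 3 * ?n" using total by linarith
    then show ?thesis by (simp add: high del: traj.simps period.simps)
  qed
qed

section \<open>Cycles of the first-return map\<close>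

definition small_low :: "nat \<Rightarrow> state set" where
  "small_low a = (\<lambda>p. (p, 0, 1)) ` {..<a - 1}"

definition small_high :: "nat \<Rightarrow> state set" where
  "small_high a = (\<lambda>s. (a, 1, s)) ` ({..a} - {1, 2})"

definition medium_cycle :: "nat \<Rightarrow> state set" where
  "medium_cycle a = {(a - 1, 0, 1), (a, 1, 1), (a, 1, 2)}"

text \<open>Torus coordinates: \<open>u\<close> numbers the values 0, 2, ..., \<open>a\<close> of
  the third coordinate, and \<open>d\<close> is the first coordinate minus \<open>u\<close> modulo
  \<open>a\<close>. Both advance together under \<open>ret a\<close>, so \<open>d\<close> labels the
  cycle.\<close>

definition large_point :: "nat \<Rightarrow> nat \<Rightarrow> nat \<Rightarrow> state" where
  "large_point a d u =
    (if u + d < a then u + d else u + d - a, 0, if u = 0 then 0 else u + 1)"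

definition large_cycle :: "nat \<Rightarrow> nat \<Rightarrow> state set" where
  "large_cycle a d = large_point a d ` {..<a}"

abbreviation orb :: "nat \<Rightarrow> state \<Rightarrow> state set" where
  "orb a t \<equiv> reachable {step a} t"

lemma cross_section_eq:
  assumes "2 \<le> a"
  shows "cross_section a =
    small_low a \<union> small_high a \<union> medium_cycle a \<union> (\<Union>d<a. large_cycle a d)"
proof
  show "cross_section a \<subseteq> small_low a \<union> small_high a \<union> medium_cycle a \<union> (\<Union>d<a. large_cycle a d)"
  proof
    fix t assume "t \<in> cross_section a"
    then show "t \<in> small_low a \<union> small_high a \<union> medium_cycle a \<union> (\<Union>d<a. large_cycle a d)"
    proof (cases rule: cross_section_cases)
      case (low p r)
      show ?thesis
      proof (cases "r = 1")
        case True
        then show ?thesis using low by (auto simp: small_low_def medium_cycle_def)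
      next
        case False
        \<comment> \<open>Reading off \<open>u\<close> and \<open>d\<close> inverts
          \<open>large_point\<close>.\<close>
        define u where "u = (if r = 0 then 0 else r - 1)"
        define d where "d = (if u \<le> p then p - u else p + a - u)"
        have "u < a" "d < a" "large_point a d u = t"
          using low False assms by (auto simp: u_def d_def large_point_def)
        then show ?thesis by (auto simp: large_cycle_def)
      qed
    next
      case (high s)
      then show ?thesis by (auto simp: small_high_def medium_cycle_def)
    qed
  qed
  show "small_low a \<union> small_high a \<union> medium_cycle a \<union> (\<Union>d<a. large_cycle a d) \<subseteq> cross_section a"
    using assms
    by (auto simp: small_low_def small_high_def medium_cycle_def large_cycle_def large_point_def
        cross_section_def states_def split: if_splits)
qed

lemma ret_small: "t \<in> small_low a \<union> small_high a \<Longrightarrow> ret a t = t"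
  by (auto simp: small_low_def small_high_def split: if_splits)

lemma ret_large_point:
  assumes "2 \<le> a" and "u < a" and "d < a"
  shows "ret a (large_point a d u) = large_point a d (if u + 1 < a then u + 1 else 0)"
  using assms by (auto simp: large_point_def)

lemma orbit_of_cycle:
  assumes a: "2 \<le> a" and C: "C \<subseteq> cross_section a" "t \<in> C" "\<And>s. s \<in> C \<Longrightarrow> ret a s \<in> C"
    and reach: "C \<subseteq> orb a t"
  shows "orb a t \<inter> cross_section a = C"
    and "card (orb a t) = (\<Sum>s\<in>C. period a s)"
    and "(\<Sum>x\<in>orb a t. weight a x) = (\<Sum>s\<in>C. \<Sum>k<period a s. weight a (traj a s k))"
proof -
  interpret first_return "step a" "states a" "cross_section a" "period a"
    using a by (rule first_return_step)
  have eq: "orb a t = (\<Union>s\<in>C. run s)"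
    using C reach funpow_step_period[OF a] by (intro reachable_eq_runs) auto
  show "orb a t \<inter> cross_section a = C" unfolding eq by (rule runs_Int[OF C(1)])
  show "card (orb a t) = (\<Sum>s\<in>C. period a s)" unfolding eq by (rule card_runs[OF C(1)])
  show "(\<Sum>x\<in>orb a t. weight a x) = (\<Sum>s\<in>C. \<Sum>k<period a s. weight a (traj a s k))"
    unfolding eq sum_runs[OF C(1)]
    by (intro sum.cong refl arg_cong[of _ _ "weight a"] funpow_step[OF a]) (use C in auto)
qed

lemma ret_in_orb:
  assumes "2 \<le> a" and "s \<in> cross_section a" and "s \<in> orb a t"
  shows "ret a s \<in> orb a t"
proof -
  interpret first_return "step a" "states a" "cross_section a" "period a"
    using assms(1) by (rule first_return_step)
  have "ret a s \<in> orb a s"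
    using funpow_reachable funpow_step_period[OF assms(1,2)] by metis
  with assms(3) show ?thesis by (rule reachable_trans)
qed

lemma orb_eq:
  assumes "2 \<le> a" and "x \<in> states a" and "y \<in> orb a x"
  shows "orb a y = orb a x"
proof -
  interpret first_return "step a" "states a" "cross_section a" "period a"
    using assms(1) by (rule first_return_step)
  show ?thesis using assms(2,3) by (rule reachable_eq_single)
qed

text \<open>A single run of length \<open>a + 1\<close> with its three gaps:
  \<open>3 * (a + 1) - 3\<close>.\<close>

lemma small_orbit:
  assumes a: "2 \<le> a" and t: "t \<in> small_low a \<union> small_high a"
  shows "orb a t \<inter> cross_section a = {t}"
    and "card (orb a t) = a + 1"
    and "(\<Sum>x\<in>orb a t. weight a x) = 3 * a"
proof -
  have T: "t \<in> cross_section a" using t cross_section_eq[OF a] by blast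
  have *: "{t} \<subseteq> cross_section a" "t \<in> {t}" "\<And>s. s \<in> {t} \<Longrightarrow> ret a s \<in> {t}" "{t} \<subseteq> orb a t"
    using T ret_small[OF t] by auto
  have per: "period a t = a + 1" using t by (auto simp: small_low_def small_high_def split: if_splits)
  have "(case t of (p, q, r) \<Rightarrow> if q = 0 \<and> r \<noteq> 1 then of_bool (p = 0) + of_bool (r = 0) else 0) = (0::nat)"
    using t by (auto simp: small_low_def small_high_def)
  then have w: "(\<Sum>k<period a t. weight a (traj a t k)) = 3 * a"
    using sum_weight_run[OF a T] per by simp
  show "orb a t \<inter> cross_section a = {t}" by (rule orbit_of_cycle[OF a *])
  show "card (orb a t) = a + 1" using orbit_of_cycle(2)[OF a *] per by simp
  show "(\<Sum>x\<in>orb a t. weight a x) = 3 * a" using orbit_of_cycle(3)[OF a *] w by simp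
qed

text \<open>The runs have lengths \<open>a + 1\<close>, \<open>a + 1\<close> and \<open>a\<close>,
  each with three gaps, hence the total weight \<open>3 * (3 * a + 2) - 9\<close>.\<close>

lemma medium_orbit:
  assumes a: "2 \<le> a" and t: "t \<in> medium_cycle a"
  shows "orb a t = orb a (a - 1, 0, 1)"
    and "orb a (a - 1, 0, 1) \<inter> cross_section a = medium_cycle a"
    and "card (orb a (a - 1, 0, 1)) = 3 * a + 2"
    and "(\<Sum>x\<in>orb a (a - 1, 0, 1). weight a x) = 9 * a - 3"
proof -
  let ?t = "(a - 1, 0, 1)"
  let ?x = "(a, 1, 1)" let ?y = "(a, 1, 2)"
  have M: "medium_cycle a \<subseteq> cross_section a" using cross_section_eq[OF a] by blast
  have r: "ret a ?t = ?x" "ret a ?x = ?y" "ret a ?y = ?t" using a by auto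
  have S: "?t \<in> cross_section a" "?x \<in> cross_section a" "?y \<in> cross_section a"
    using M by (auto simp: medium_cycle_def)
  have "?x \<in> orb a ?t" using ret_in_orb[OF a S(1), of ?t] unfolding r by simp
  moreover from this have "?y \<in> orb a ?t" using ret_in_orb[OF a S(2), of ?t] unfolding r by simp
  ultimately have sub: "medium_cycle a \<subseteq> orb a ?t" by (simp add: medium_cycle_def)
  have *: "medium_cycle a \<subseteq> cross_section a" "?t \<in> medium_cycle a"
    "\<And>s. s \<in> medium_cycle a \<Longrightarrow> ret a s \<in> medium_cycle a" "medium_cycle a \<subseteq> orb a ?t"
    using M sub r unfolding medium_cycle_def by (auto simp del: ret.simps)
  have sumM: "(\<Sum>s\<in>medium_cycle a. g s) = g ?t + g ?x + g ?y" for g :: "state \<Rightarrow> nat"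
    unfolding medium_cycle_def by simp
  define W where "W s = (\<Sum>k<period a s. weight a (traj a s k))" for s
  have w: "W ?t + 3 = 3 * (a + 1)" "W ?x + 3 = 3 * (a + 1)" "W ?y + 3 = 3 * a"
    unfolding W_def
    using sum_weight_run[OF a S(1)] sum_weight_run[OF a S(2)] sum_weight_run[OF a S(3)]
    by (simp_all del: traj.simps)
  show "orb a ?t \<inter> cross_section a = medium_cycle a" by (rule orbit_of_cycle[OF a *])
  show "card (orb a ?t) = 3 * a + 2"
    by (subst orbit_of_cycle(2)[OF a *]) (use a in \<open>simp_all add: sumM\<close>)
  have "(\<Sum>x\<in>orb a ?t. weight a x) = W ?t + W ?x + W ?y"
    using orbit_of_cycle(3)[OF a *] by (simp only: sumM W_def)
  then show "(\<Sum>x\<in>orb a ?t. weight a x) = 9 * a - 3"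
    using w by simp
  show "orb a t = orb a ?t"
    by (rule orb_eq[OF a]) (use S sub t cross_section_subset in auto)
qed

lemma inj_on_large_point: "inj_on (large_point a d) {..<a}"
  by (rule inj_onI) (auto simp: large_point_def split: if_splits)

text \<open>All \<open>a\<close> runs have length \<open>a + 2\<close>. Besides three gaps per run
  the cycle has two more, one from the start with first coordinate 0 and one from the start with
  third coordinate 0; this is the \<open>- 2\<close> in the total.\<close>

lemma large_orbit:
  assumes a: "2 \<le> a" and d: "d < a"
  shows "t \<in> large_cycle a d \<Longrightarrow> orb a t = orb a (d, 0, 0)"
    and "orb a (d, 0, 0) \<inter> cross_section a = large_cycle a d"
    and "card (orb a (d, 0, 0)) = a\<^sup>2 + 2 * a"
    and "(\<Sum>x\<in>orb a (d, 0, 0). weight a x) = 3 * a\<^sup>2 + 3 * a - 2"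
proof -
  let ?t = "(d, 0, 0)"
  have M: "large_cycle a d \<subseteq> cross_section a" using cross_section_eq[OF a] d by blast
  have t0: "large_point a d 0 = ?t" using d by (simp add: large_point_def)
  have pt: "large_point a d u \<in> orb a ?t" if "u < a" for u
    using that
  proof (induction u)
    case 0
    then show ?case by (simp add: t0)
  next
    case (Suc u)
    then have "large_point a d u \<in> orb a ?t" by simp
    then have "ret a (large_point a d u) \<in> orb a ?t"
      by (rule ret_in_orb[OF a, rotated]) (use M Suc in \<open>auto simp: large_cycle_def\<close>)
    then show ?case using ret_large_point[OF a _ d, of u] Suc by simp
  qed
  have *: "large_cycle a d \<subseteq> cross_section a" "?t \<in> large_cycle a d"
    "\<And>s. s \<in> large_cycle a d \<Longrightarrow> ret a s \<in> large_cycle a d" "large_cycle a d \<subseteq> orb a ?t"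
  proof -
    show "?t \<in> large_cycle a d" using a unfolding large_cycle_def by (intro image_eqI[of _ _ 0]) (auto simp: t0)
    show "ret a s \<in> large_cycle a d" if s: "s \<in> large_cycle a d" for s
    proof -
      obtain u where u: "u < a" "s = large_point a d u" using s by (auto simp: large_cycle_def)
      then show ?thesis
        using ret_large_point[OF a u(1) d] a by (auto simp: large_cycle_def simp del: ret.simps)
    qed
    show "large_cycle a d \<subseteq> orb a ?t" using pt by (auto simp: large_cycle_def)
  qed (rule M)
  have sumC: "(\<Sum>s\<in>large_cycle a d. g s) = (\<Sum>u<a. g (large_point a d u))" for g :: "state \<Rightarrow> nat"
    unfolding large_cycle_def by (subst sum.reindex[OF inj_on_large_point]) simp
  have per: "period a (large_point a d u) = a + 2" for u by (simp add: large_point_def)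
  define W where "W s = (\<Sum>k<period a s. weight a (traj a s k))" for s
  \<comment> \<open>The solution of \<open>u + d = 0\<close> modulo \<open>a\<close>, where the
    first coordinate vanishes.\<close>
  let ?z = "if d = 0 then 0 else a - d"
  have w: "W (large_point a d u) + of_bool (u = ?z) + of_bool (u = 0) = 3 * a + 3"
    if "u < a" for u
  proof -
    have "large_point a d u \<in> cross_section a" using that M by (auto simp: large_cycle_def)
    moreover have "(case large_point a d u of (p, q, r) \<Rightarrow>
        if q = 0 \<and> r \<noteq> 1 then of_bool (p = 0) + of_bool (r = 0) else 0) =
      (of_bool (fst (large_point a d u) = 0) + of_bool (u = 0) :: nat)"
      by (simp add: large_point_def)
    ultimately have "W (large_point a d u) + 3 +
        (of_bool (fst (large_point a d u) = 0) + of_bool (u = 0)) = 3 * (a + 2)"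
      using sum_weight_run[OF a, of "large_point a d u"] by (simp only: per W_def)
    moreover have "of_bool (fst (large_point a d u) = 0) = (of_bool (u = ?z) :: nat)"
      using that d by (auto simp: large_point_def)
    ultimately show ?thesis by simp
  qed
  have "(\<Sum>u<a. W (large_point a d u) + of_bool (u = ?z) + of_bool (u = 0)) =
      (\<Sum>u<a. 3 * a + 3)"
    by (intro sum.cong refl w) simp
  moreover have "?z < a" "0 < a" using a by auto
  then have "(\<Sum>u<a. of_bool (u = ?z) :: nat) = 1" "(\<Sum>u<a. of_bool (u = 0) :: nat) = 1"
    unfolding of_bool_def by simp_all
  ultimately have total: "(\<Sum>u<a. W (large_point a d u)) + 2 = a * (3 * a + 3)"
    unfolding sum.distrib by (simp add: distrib_left)
  show "orb a ?t \<inter> cross_section a = large_cycle a d" by (rule orbit_of_cycle[OF a *])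
  have "card (orb a ?t) = (\<Sum>u<a. a + 2)"
    using orbit_of_cycle(2)[OF a *] by (simp only: sumC per)
  then show "card (orb a ?t) = a\<^sup>2 + 2 * a"
    by (simp add: power2_eq_square algebra_simps)
  have "(\<Sum>x\<in>orb a ?t. weight a x) = (\<Sum>u<a. W (large_point a d u))"
    using orbit_of_cycle(3)[OF a *] by (simp only: sumC W_def)
  moreover have "a * (3 * a + 3) = 3 * a\<^sup>2 + 3 * a" by (simp add: power2_eq_square algebra_simps)
  ultimately show "(\<Sum>x\<in>orb a ?t. weight a x) = 3 * a\<^sup>2 + 3 * a - 2"
    using total by linarith
  have "?t \<in> states a" using *(2) M cross_section_subset by blast
  then show "t \<in> large_cycle a d \<Longrightarrow> orb a t = orb a ?t"
    by (rule orb_eq[OF a]) (use *(4) in auto)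
qed

text \<open>The dual of a state in the cross-section has its second coordinate about to fall back;
  one more step returns to the cross-section within the same orbit.\<close>

lemma orb_dual:
  assumes "2 \<le> a" and "t \<in> states a"
  shows "orb a (dual a t) = orb a (step a (dual a t))"
  using orb_eq[OF assms(1) dual_in_states[OF assms(2)], of "step a (dual a t)"]
  by (simp add: reachable_step)

lemma step_dual_small_low:
  assumes "2 \<le> a" and "t \<in> small_low a"
  shows "step a (dual a t) \<in> small_high a"
proof -
  obtain p where p: "t = (p, 0, 1)" "p < a - 1" using assms(2) by (auto simp: small_low_def)
  then have "step a (dual a t) = (a, 1, if p = 0 then 0 else a - p + 1)"
    using assms(1) by auto
  \<comment> \<open>For \<open>0 < p < a - 1\<close> the value \<open>a - p + 1\<close> runs through
    3, ..., \<open>a\<close>, avoiding the medium values 1 and 2.\<close>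
  moreover have "(if p = 0 then 0 else a - p + 1) \<in> {..a} - {1, 2}" using p by auto
  ultimately show ?thesis unfolding small_high_def by blast
qed

lemma step_dual_small_high:
  assumes "2 \<le> a" and "t \<in> small_high a"
  shows "step a (dual a t) \<in> small_low a"
proof -
  obtain s where s: "t = (a, 1, s)" "s \<le> a" "s \<noteq> 1" "s \<noteq> 2"
    using assms(2) by (auto simp: small_high_def)
  then have "step a (dual a t) = (if s = 0 then 0 else a - s + 1, 0, 1)"
    using assms(1) by auto
  moreover have "(if s = 0 then 0 else a - s + 1) < a - 1" using s assms(1) by auto
  ultimately show ?thesis by (auto simp: small_low_def)
qed

lemma step_dual_medium:
  assumes "2 \<le> a" and "t \<in> medium_cycle a"
  shows "step a (dual a t) \<in> medium_cycle a"
  using assms by (auto simp: medium_cycle_def split: if_splits)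

text \<open>On the torus the pair (\<open>p\<close>, \<open>u\<close>) goes to (\<open>- u\<close>,
  \<open>- p\<close>) modulo \<open>a\<close>, which preserves the label
  \<open>d = p - u\<close>.\<close>

lemma step_dual_large:
  assumes "2 \<le> a" and "d < a" and "t \<in> large_cycle a d"
  shows "step a (dual a t) \<in> large_cycle a d"
proof -
  obtain u where u: "u < a" "t = large_point a d u" using assms(3) by (auto simp: large_cycle_def)
  define p where "p = (if u + d < a then u + d else u + d - a)"
  define v where "v = (if p = 0 then 0 else a - p)"
  have p: "p < a" using u assms(2) by (auto simp: p_def)
  have t: "t = (p, 0, if u = 0 then 0 else u + 1)" using u by (simp add: large_point_def p_def)
  have "step a (dual a t) = (if u = 0 then 0 else a - u, 0, if p = 0 then 0 else a - p + 1)"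
    using p u(1) assms(1) unfolding t by (cases "u = 0"; cases "p = 0") auto
  also have "\<dots> = large_point a d v"
    using u assms(1,2) by (auto simp: v_def p_def large_point_def)
  finally show ?thesis using p assms(1) by (auto simp: large_cycle_def v_def)
qed

section \<open>Classification of the orbits\<close>

definition small_orbits :: "nat \<Rightarrow> state set set" where
  "small_orbits a = orb a ` (small_low a \<union> small_high a)"

definition medium_orbits :: "nat \<Rightarrow> state set set" where
  "medium_orbits a = {orb a (a - 1, 0, 1)}"

definition large_orbits :: "nat \<Rightarrow> state set set" where
  "large_orbits a = (\<lambda>d. orb a (d, 0, 0)) ` {..<a}"

text \<open>The third coordinate vanishes only at \<open>u = 0\<close>, so the label
  \<open>d\<close> can be read off from the orbit.\<close>

lemma large_orbit_Int_0:
  assumes "2 \<le> a" and "d < a"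
  shows "orb a (d, 0, 0) \<inter> cross_section a \<inter> {(p, 0, 0) | p. True} = {(d, 0, 0)}"
  unfolding large_orbit(2)[OF assms]
proof -
  have "(d, 0, 0) = large_point a d 0" using assms by (simp add: large_point_def)
  then have "(d, 0, 0) \<in> large_cycle a d" using assms by (auto simp: large_cycle_def)
  moreover have "t = (d, 0, 0)" if "t \<in> large_cycle a d" "t = (p, 0, 0)" for t p
    using that assms by (auto simp: large_cycle_def large_point_def split: if_splits)
  ultimately show "large_cycle a d \<inter> {(p, 0, 0) | p. True} = {(d, 0, 0)}" by auto
qed

lemma inj_on_large:
  assumes "2 \<le> a"
  shows "inj_on (\<lambda>d. orb a (d, 0, 0)) {..<a}"
proof (rule inj_onI)
  fix d e assume "d \<in> {..<a}" "e \<in> {..<a}" and eq: "orb a (d, 0, 0) = orb a (e, 0, 0)"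
  then show "d = e"
    using large_orbit_Int_0[OF assms, of d] large_orbit_Int_0[OF assms, of e] unfolding eq by simp
qed

lemma inj_on_small:
  assumes "2 \<le> a"
  shows "inj_on (orb a) (small_low a \<union> small_high a)"
proof (rule inj_onI)
  fix s t assume st: "s \<in> small_low a \<union> small_high a" "t \<in> small_low a \<union> small_high a"
    and eq: "orb a s = orb a t"
  show "s = t"
    using small_orbit(1)[OF assms st(1)] small_orbit(1)[OF assms st(2)] unfolding eq by simp
qed

lemma card_small_orbits:
  assumes "2 \<le> a"
  shows "card (small_orbits a) = 2 * a - 2"
proof -
  have "card (small_low a) = a - 1"
    unfolding small_low_def by (subst card_image) (auto simp: inj_on_def)
  moreover have "card ({..a} - {1, 2}) = a - 1"
    using assms by (subst card_Diff_subset) auto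
  then have "card (small_high a) = a - 1"
    unfolding small_high_def by (subst card_image) (auto simp: inj_on_def)
  moreover have "finite (small_low a)" "finite (small_high a)" "small_low a \<inter> small_high a = {}"
    by (auto simp: small_low_def small_high_def)
  ultimately have "card (small_low a \<union> small_high a) = 2 * a - 2"
    by (subst card_Un_disjoint) auto
  then show ?thesis
    unfolding small_orbits_def using card_image[OF inj_on_small[OF assms]] by simp
qed

text \<open>The traces on the cross-section are compared. The last two coordinates of their states
  separate the classes, except that \<open>(p, 0, 1)\<close> is medium exactly for
  \<open>p = a - 1\<close>.\<close>

lemma orbits_disjoint:
  assumes a: "2 \<le> a"
  shows "small_orbits a \<inter> medium_orbits a = {}" "small_orbits a \<inter> large_orbits a = {}"
    "medium_orbits a \<inter> large_orbits a = {}"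
proof -
  have S: "\<exists>t \<in> small_low a \<union> small_high a. U \<inter> cross_section a = {t}" if "U \<in> small_orbits a" for U
    using that small_orbit(1)[OF a] by (auto simp: small_orbits_def)
  have M: "U \<inter> cross_section a = medium_cycle a" if "U \<in> medium_orbits a" for U
    using that medium_orbit(2)[OF a, of "(a, 1, 1)"]
    by (simp add: medium_orbits_def medium_cycle_def)
  have L: "\<exists>d<a. U \<inter> cross_section a = large_cycle a d" if "U \<in> large_orbits a" for U
    using that large_orbit(2)[OF a] unfolding large_orbits_def by blast
  have S': "fst (snd t) = 0 \<and> snd (snd t) = 1 \<and> fst t \<noteq> a - 1 \<or>
      fst (snd t) = 1 \<and> snd (snd t) \<noteq> 1 \<and> snd (snd t) \<noteq> 2"
    if "t \<in> small_low a \<union> small_high a" for t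
    using that unfolding small_low_def small_high_def by auto
  have M': "fst (snd t) = 0 \<and> snd (snd t) = 1 \<and> fst t = a - 1 \<or>
      fst (snd t) = 1 \<and> (snd (snd t) = 1 \<or> snd (snd t) = 2)"
    if "t \<in> medium_cycle a" for t
    using that unfolding medium_cycle_def by auto
  have L': "fst (snd t) = 0 \<and> snd (snd t) \<noteq> 1" if "t \<in> large_cycle a d" for t d
    using that unfolding large_cycle_def large_point_def by (auto split: if_splits)
  have D: "(small_low a \<union> small_high a) \<inter> medium_cycle a = {}"
    using S' M' by (metis disjoint_iff zero_neq_one)
  have D2: "(small_low a \<union> small_high a) \<inter> large_cycle a d = {}" for d
    using S' L' by (metis disjoint_iff zero_neq_one)
  have D3: "medium_cycle a \<inter> large_cycle a d = {}" for d
    using M' L' by (metis disjoint_iff zero_neq_one)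
  have ne: "medium_cycle a \<noteq> {}" by (simp add: medium_cycle_def)
  show "small_orbits a \<inter> medium_orbits a = {}"
  proof (rule equals0I)
    fix U assume U: "U \<in> small_orbits a \<inter> medium_orbits a"
    then obtain t where "t \<in> small_low a \<union> small_high a" "U \<inter> cross_section a = {t}"
      using S[of U] by blast
    moreover have "U \<inter> cross_section a = medium_cycle a" using U M[of U] by blast
    ultimately show False using D by blast
  qed
  show "small_orbits a \<inter> large_orbits a = {}"
  proof (rule equals0I)
    fix U assume U: "U \<in> small_orbits a \<inter> large_orbits a"
    then obtain t where "t \<in> small_low a \<union> small_high a" "U \<inter> cross_section a = {t}"
      using S[of U] by blast
    moreover obtain d where "U \<inter> cross_section a = large_cycle a d" using U L[of U] by blast
    ultimately show False using D2[of d] by blast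
  qed
  show "medium_orbits a \<inter> large_orbits a = {}"
  proof (rule equals0I)
    fix U assume U: "U \<in> medium_orbits a \<inter> large_orbits a"
    then obtain d where "U \<inter> cross_section a = large_cycle a d" using L[of U] by blast
    moreover have "U \<inter> cross_section a = medium_cycle a" using U M[of U] by blast
    ultimately show False using D3[of d] ne by simp
  qed
qed

lemma orbit_statistics:
  assumes a: "2 \<le> a"
  shows "U \<in> small_orbits a \<Longrightarrow> card U = a + 1 \<and> (\<Sum>t\<in>U. weight a t) = 3 * a"
    and "U \<in> medium_orbits a \<Longrightarrow> card U = 3 * a + 2 \<and> (\<Sum>t\<in>U. weight a t) = 9 * a - 3"
    and "U \<in> large_orbits a \<Longrightarrow>
      card U = a\<^sup>2 + 2 * a \<and> (\<Sum>t\<in>U. weight a t) = 3 * a\<^sup>2 + 3 * a - 2"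
proof -
  show "card U = a + 1 \<and> (\<Sum>t\<in>U. weight a t) = 3 * a" if "U \<in> small_orbits a"
    using that small_orbit(2,3)[OF a] unfolding small_orbits_def by blast
  have "(a, 1, 1) \<in> medium_cycle a" by (simp add: medium_cycle_def)
  then show "card U = 3 * a + 2 \<and> (\<Sum>t\<in>U. weight a t) = 9 * a - 3" if "U \<in> medium_orbits a"
    using that medium_orbit(3,4)[OF a] unfolding medium_orbits_def by blast
  show "card U = a\<^sup>2 + 2 * a \<and> (\<Sum>t\<in>U. weight a t) = 3 * a\<^sup>2 + 3 * a - 2"
    if "U \<in> large_orbits a"
    using that large_orbit(3,4)[OF a] unfolding large_orbits_def by blast
qed

lemma generated_orbits_step:
  assumes a: "2 \<le> a"
  shows "generated_orbits (states a) {step a} = small_orbits a \<union> medium_orbits a \<union> large_orbits a"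
proof -
  interpret first_return "step a" "states a" "cross_section a" "period a"
    using a by (rule first_return_step)
  have "orb a ` medium_cycle a = (\<lambda>_. orb a (a - 1, 0, 1)) ` medium_cycle a"
    by (intro image_cong refl medium_orbit(1)[OF a])
  then have "orb a ` medium_cycle a = medium_orbits a"
    by (simp add: image_constant_conv medium_orbits_def medium_cycle_def)
  moreover have "orb a ` large_cycle a d = {orb a (d, 0, 0)}" if "d < a" for d
  proof -
    have "orb a ` large_cycle a d = (\<lambda>_. orb a (d, 0, 0)) ` large_cycle a d"
      by (intro image_cong refl large_orbit(1)[OF a that])
    moreover have "large_cycle a d \<noteq> {}" using that by (auto simp: large_cycle_def)
    ultimately show ?thesis by (simp add: image_constant_conv)
  qed
  then have "orb a ` (\<Union>d<a. large_cycle a d) = large_orbits a"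
    unfolding image_UN large_orbits_def by auto
  ultimately show ?thesis
    unfolding generated_orbits_section cross_section_eq[OF a] small_orbits_def image_Un by simp
qed

lemma generated_orbits_step_dual:
  assumes a: "2 \<le> a"
  shows "generated_orbits (states a) {step a, dual a} =
    (\<lambda>t. orb a t \<union> orb a (step a (dual a t))) ` cross_section a"
proof -
  interpret first_return "step a" "states a" "cross_section a" "period a"
    using a by (rule first_return_step)
  have "generated_orbits (states a) {step a, dual a} =
    (\<lambda>t. orb a t \<union> orb a (dual a t)) ` cross_section a"
    by (rule generated_orbits_reversing)
      (use a dual_in_states dual_dual step_dual_step in \<open>simp_all add: Pi_iff del: split_paired_All\<close>)
  also have "\<dots> = (\<lambda>t. orb a t \<union> orb a (step a (dual a t))) ` cross_section a"
    by (intro image_cong refl arg_cong2[of _ _ _ _ "(\<union>)"] orb_dual[OF a])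
      (use cross_section_subset in blast)
  finally show ?thesis .
qed

text \<open>Duality exchanges the disjoint sets \<open>small_low a\<close> and
  \<open>small_high a\<close>, and a small orbit has only one state in the cross-section, so it
  cannot be its own dual.\<close>

lemma small_pairing:
  assumes a: "2 \<le> a" and t: "t \<in> small_low a \<union> small_high a"
  shows "orb a (step a (dual a t)) \<in> small_orbits a" "orb a t \<noteq> orb a (step a (dual a t))"
proof -
  let ?s = "step a (dual a t)"
  have s: "?s \<in> small_low a \<union> small_high a"
    using t step_dual_small_low[OF a] step_dual_small_high[OF a] by blast
  then show "orb a ?s \<in> small_orbits a" by (simp add: small_orbits_def)
  have "small_low a \<inter> small_high a = {}" by (auto simp: small_low_def small_high_def)
  then have "?s \<noteq> t"
    using t step_dual_small_low[OF a, of t] step_dual_small_high[OF a, of t]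
    by (metis IntI UnE emptyE)
  then show "orb a t \<noteq> orb a ?s"
    using inj_on_small[OF a] s t by (auto dest: inj_onD)
qed

lemma dual_orbit_eq:
  assumes a: "2 \<le> a" and t: "t \<in> cross_section a" "t \<notin> small_low a \<union> small_high a"
  shows "orb a (step a (dual a t)) = orb a t" "orb a t \<in> medium_orbits a \<union> large_orbits a"
proof -
  consider "t \<in> medium_cycle a" | d where "d < a" "t \<in> large_cycle a d"
    using t cross_section_eq[OF a] by auto
  then have "orb a (step a (dual a t)) = orb a t \<and> orb a t \<in> medium_orbits a \<union> large_orbits a"
  proof cases
    case 1
    then show ?thesis
      using medium_orbit(1)[OF a 1] medium_orbit(1)[OF a step_dual_medium[OF a 1]]
      by (simp add: medium_orbits_def)
  next
    case 2
    then show ?thesis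
      using large_orbit(1)[OF a 2] large_orbit(1)[OF a 2(1) step_dual_large[OF a 2]]
      by (simp add: large_orbits_def)
  qed
  then show "orb a (step a (dual a t)) = orb a t" "orb a t \<in> medium_orbits a \<union> large_orbits a"
    by blast+
qed

lemma dihedral_classification:
  assumes a: "2 \<le> a"
  shows "D \<in> generated_orbits (states a) {step a, dual a} \<Longrightarrow>
      (\<exists>U\<in>small_orbits a. \<exists>V\<in>small_orbits a. U \<noteq> V \<and> D = U \<union> V) \<or>
      D \<in> medium_orbits a \<union> large_orbits a"
    and "U \<in> small_orbits a \<Longrightarrow>
      \<exists>V\<in>small_orbits a. U \<noteq> V \<and> U \<union> V \<in> generated_orbits (states a) {step a, dual a}"
    and "U \<in> medium_orbits a \<union> large_orbits a \<Longrightarrow>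
      U \<in> generated_orbits (states a) {step a, dual a}"
proof -
  let ?S = "small_low a \<union> small_high a"
  show "(\<exists>U\<in>small_orbits a. \<exists>V\<in>small_orbits a. U \<noteq> V \<and> D = U \<union> V) \<or>
      D \<in> medium_orbits a \<union> large_orbits a"
    if "D \<in> generated_orbits (states a) {step a, dual a}"
  proof -
    obtain t where t: "t \<in> cross_section a" "D = orb a t \<union> orb a (step a (dual a t))"
      using \<open>D \<in> _\<close> unfolding generated_orbits_step_dual[OF a] by blast
    show ?thesis
    proof (cases "t \<in> ?S")
      case True
      then show ?thesis using small_pairing[OF a True] t by (auto simp: small_orbits_def)
    next
      case False
      then show ?thesis using dual_orbit_eq[OF a t(1) False] t(2) by simp
    qed
  qed
  have sub: "?S \<subseteq> cross_section a" using cross_section_eq[OF a] by blast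
  show "\<exists>V\<in>small_orbits a. U \<noteq> V \<and> U \<union> V \<in> generated_orbits (states a) {step a, dual a}"
    if "U \<in> small_orbits a"
  proof -
    obtain t where t: "t \<in> ?S" "U = orb a t"
      using \<open>U \<in> _\<close> unfolding small_orbits_def by blast
    then show ?thesis
      using small_pairing[OF a t(1)] sub unfolding generated_orbits_step_dual[OF a] by blast
  qed
  show "U \<in> generated_orbits (states a) {step a, dual a}"
    if U: "U \<in> medium_orbits a \<union> large_orbits a"
  proof -
    have "U \<in> generated_orbits (states a) {step a}"
      unfolding generated_orbits_step[OF a] using U by blast
    then obtain t where t: "t \<in> cross_section a" "U = orb a t"
      unfolding first_return.generated_orbits_section[OF first_return_step[OF a]] by blast
    have "t \<notin> ?S"
      using U t orbits_disjoint[OF a] unfolding small_orbits_def by blast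
    then have "U = orb a t \<union> orb a (step a (dual a t))"
      using dual_orbit_eq(1)[OF a t(1)] t(2) by simp
    then show ?thesis unfolding generated_orbits_step_dual[OF a] using t(1) by blast
  qed
qed

theorem theorem4p6:
  fixes a :: nat
  assumes "a \<ge> 2"
  shows "\<exists>\<S> \<M> \<L> :: nat set set set.
    (\<S> \<union> \<M> \<union> \<L> = rowmotion_orbits (fence a) \<and>
     \<S> \<inter> \<M> = {} \<and> \<S> \<inter> \<L> = {} \<and> \<M> \<inter> \<L> = {}) \<and>
    (card \<S> = 2 * a - 2 \<and> card \<M> = 1 \<and> card \<L> = a \<and>
     (\<forall>U\<in>\<S>. card U = a + 1) \<and>
     (\<forall>U\<in>\<M>. card U = 3 * a + 2) \<and>
     (\<forall>U\<in>\<L>. card U = a\<^sup>2 + 2 * a)) \<and>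
    ((a \<noteq> 2 \<longrightarrow> chi_homometric (fence a)) \<and>
     (\<forall>U\<in>\<S>. chi U = 3 * a) \<and>
     (\<forall>U\<in>\<M>. chi U = 9 * a - 3) \<and>
     (\<forall>U\<in>\<L>. chi U = 3 * a\<^sup>2 + 3 * a - 2)) \<and>
    ((\<forall>D\<in>dihedral_orbits a.
        (\<exists>U\<in>\<S>. \<exists>V\<in>\<S>. U \<noteq> V \<and> D = ideal_orbit (fence a) U \<union> ideal_orbit (fence a) V) \<or>
        (\<exists>U\<in>\<M> \<union> \<L>. D = ideal_orbit (fence a) U)) \<and>
     (\<forall>U\<in>\<S>. \<exists>V\<in>\<S>. U \<noteq> V \<and>
        ideal_orbit (fence a) U \<union> ideal_orbit (fence a) V \<in> dihedral_orbits a) \<and>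
     (\<forall>U\<in>\<M> \<union> \<L>. ideal_orbit (fence a) U \<in> dihedral_orbits a))"
proof -
  \<comment> \<open>\<open>\<Phi>\<close> carries orbits of triples to orbits of antichains; its
    injectivity on \<open>?O\<close> transfers all counts.\<close>
  define \<Phi> where "\<Phi> = (`) (antichain_of a)"
  let ?S = "small_orbits a" and ?M = "medium_orbits a" and ?L = "large_orbits a"
  let ?O = "?S \<union> ?M \<union> ?L"
  have a0: "0 < a" using assms by simp
  have "?O \<subseteq> Pow (states a)"
  proof -
    have "orb a t \<subseteq> states a" if "t \<in> cross_section a" for t
      using that cross_section_subset step_in_states[OF assms] by (intro reachable_subset) auto
    then show ?thesis
      unfolding generated_orbits_step[OF assms, symmetric]
        first_return.generated_orbits_section[OF first_return_step[OF assms]] by blast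
  qed
  then have sub: "U \<subseteq> states a" if "U \<in> ?O" for U using that by blast
  have inj: "inj_on \<Phi> ?O"
    unfolding \<Phi>_def
    by (rule inj_on_subset[OF inj_on_image_Pow[OF inj_on_antichain_of[OF a0]]]) fact
  have inj_U: "inj_on (antichain_of a) U" if "U \<in> ?O" for U
    using inj_on_antichain_of[OF a0] sub[OF that] by (rule inj_on_subset)
  have card_\<Phi>: "card (\<Phi> U) = card U" if "U \<in> ?O" for U
    unfolding \<Phi>_def using inj_U[OF that] by (rule card_image)
  have chi_\<Phi>: "chi (\<Phi> U) = (\<Sum>t\<in>U. weight a t)" if "U \<in> ?O" for U
    unfolding chi_def \<Phi>_def sum.reindex[OF inj_U[OF that]] comp_def
    by (intro sum.cong refl card_antichain_of[OF a0]) (use sub[OF that] in blast)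
  have ideal_\<Phi>: "ideal_orbit (fence a) (\<Phi> U) = ideal_of a ` U" if "U \<in> ?O" for U
    unfolding ideal_orbit_def \<Phi>_def image_image
    using sub[OF that] ideal_generated_antichain_of[OF a0] by (intro image_cong) auto
  have rows: "rowmotion_orbits (fence a) = \<Phi> ` ?O"
    unfolding \<Phi>_def rowmotion_orbits_fence[OF assms] generated_orbits_step[OF assms] ..
  have dih: "dihedral_orbits a = (`) (ideal_of a) ` generated_orbits (states a) {step a, dual a}"
    by (rule dihedral_orbits_fence[OF assms])
  have "\<Phi> ` A \<inter> \<Phi> ` B = {}" if "A \<inter> B = {}" "A \<subseteq> ?O" "B \<subseteq> ?O" for A B
    using inj_on_image_Int[OF inj that(2,3)] that(1) by simp
  then have disj: "\<Phi> ` ?S \<inter> \<Phi> ` ?M = {}" "\<Phi> ` ?S \<inter> \<Phi> ` ?L = {}" "\<Phi> ` ?M \<inter> \<Phi> ` ?L = {}"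
    using orbits_disjoint[OF assms] by (simp_all add: le_supI1)
  have num: "card (\<Phi> ` ?S) = 2 * a - 2" "card (\<Phi> ` ?M) = 1" "card (\<Phi> ` ?L) = a"
  proof -
    have "inj_on \<Phi> ?S" "inj_on \<Phi> ?L" using inj by (auto intro: inj_on_subset)
    then show "card (\<Phi> ` ?S) = 2 * a - 2" "card (\<Phi> ` ?L) = a"
      using card_small_orbits[OF assms] card_image[OF inj_on_large[OF assms]]
      by (simp_all add: card_image large_orbits_def)
    show "card (\<Phi> ` ?M) = 1" by (simp add: medium_orbits_def)
  qed
  have size: "\<forall>U\<in>\<Phi> ` ?S. card U = a + 1" "\<forall>U\<in>\<Phi> ` ?M. card U = 3 * a + 2"
    "\<forall>U\<in>\<Phi> ` ?L. card U = a\<^sup>2 + 2 * a"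
    using card_\<Phi> orbit_statistics[OF assms] by simp_all
  have chi: "\<forall>U\<in>\<Phi> ` ?S. chi U = 3 * a" "\<forall>U\<in>\<Phi> ` ?M. chi U = 9 * a - 3"
    "\<forall>U\<in>\<Phi> ` ?L. chi U = 3 * a\<^sup>2 + 3 * a - 2"
    using chi_\<Phi> orbit_statistics[OF assms] by simp_all
  \<comment> \<open>For \<open>a = 2\<close> medium and large orbits both have size 8, while
    \<open>chi\<close> is 15 and 16, so homometry fails there.\<close>
  have homometric: "a \<noteq> 2 \<longrightarrow> chi_homometric (fence a)"
  proof
    assume "a \<noteq> 2"
    then have "3 \<le> a" using assms by simp
    \<comment> \<open>This gives \<open>a\<^sup>2 + 2 * a \<ge> 5 * a\<close>, which exceeds
      \<open>3 * a + 2\<close>.\<close>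
    then have "3 * a \<le> a\<^sup>2" by (simp add: power2_eq_square)
    then have "a + 1 \<noteq> 3 * a + 2" "a + 1 \<noteq> a\<^sup>2 + 2 * a" "3 * a + 2 \<noteq> a\<^sup>2 + 2 * a"
      using \<open>3 \<le> a\<close> by linarith+
    then show "chi_homometric (fence a)"
      unfolding chi_homometric_def rows image_Un using size chi by (auto simp del: One_nat_def)
  qed
  have d1: "(\<exists>U\<in>\<Phi> ` ?S. \<exists>V\<in>\<Phi> ` ?S. U \<noteq> V \<and>
        D = ideal_orbit (fence a) U \<union> ideal_orbit (fence a) V) \<or>
      (\<exists>U\<in>\<Phi> ` ?M \<union> \<Phi> ` ?L. D = ideal_orbit (fence a) U)" if D: "D \<in> dihedral_orbits a" for D
  proof -
    obtain E where E: "E \<in> generated_orbits (states a) {step a, dual a}" "D = ideal_of a ` E"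
      using D unfolding dih by blast
    from dihedral_classification(1)[OF assms E(1)] show ?thesis
    proof
      assume "\<exists>U\<in>?S. \<exists>V\<in>?S. U \<noteq> V \<and> E = U \<union> V"
      then obtain U V where UV: "U \<in> ?S" "V \<in> ?S" "U \<noteq> V" "E = U \<union> V" by blast
      then have "\<Phi> U \<noteq> \<Phi> V" using inj by (auto dest: inj_onD)
      moreover have "D = ideal_orbit (fence a) (\<Phi> U) \<union> ideal_orbit (fence a) (\<Phi> V)"
        using UV E(2) by (simp add: ideal_\<Phi> image_Un)
      ultimately show ?thesis using UV by blast
    next
      assume E': "E \<in> ?M \<union> ?L"
      then have "D = ideal_orbit (fence a) (\<Phi> E)" using E(2) by (subst ideal_\<Phi>) auto
      then show ?thesis using E' by blast
    qed
  qed
  have d2: "\<exists>V\<in>\<Phi> ` ?S. U \<noteq> V \<and> ideal_orbit (fence a) U \<union> ideal_orbit (fence a) V \<in> dihedral_orbits a"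
    if U: "U \<in> \<Phi> ` ?S" for U
  proof -
    obtain U' where U': "U' \<in> ?S" "U = \<Phi> U'" using U by blast
    from dihedral_classification(2)[OF assms U'(1)]
    obtain V where V: "V \<in> ?S" "U' \<noteq> V" "U' \<union> V \<in> generated_orbits (states a) {step a, dual a}"
      by blast
    have "U \<noteq> \<Phi> V" using inj U' V by (auto dest: inj_onD)
    moreover have "ideal_orbit (fence a) U \<union> ideal_orbit (fence a) (\<Phi> V) = ideal_of a ` (U' \<union> V)"
      using U' V by (simp add: ideal_\<Phi> image_Un)
    ultimately show ?thesis unfolding dih using V by blast
  qed
  have d3: "ideal_orbit (fence a) U \<in> dihedral_orbits a" if U: "U \<in> \<Phi> ` ?M \<union> \<Phi> ` ?L" for U
  proof -
    obtain U' where U': "U' \<in> ?M \<union> ?L" "U = \<Phi> U'" using U by blast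
    then have "ideal_orbit (fence a) U = ideal_of a ` U'" by (subst U'(2), subst ideal_\<Phi>) auto
    then show ?thesis unfolding dih using dihedral_classification(3)[OF assms U'(1)] by blast
  qed
  show ?thesis
    by (rule exI[of _ "\<Phi> ` ?S"], rule exI[of _ "\<Phi> ` ?M"], rule exI[of _ "\<Phi> ` ?L"])
       (intro conjI ballI; fact rows[unfolded image_Un, symmetric] disj num bspec[OF size(1)] bspec[OF size(2)]
         bspec[OF size(3)] homometric bspec[OF chi(1)] bspec[OF chi(2)] bspec[OF chi(3)] d1 d2 d3)
qed

end
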